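(* Let $f,g\in\mathbb{K}[[X,Y]]$ (two variables), with $f$ irreducible, $i_0(f,X)=n<+\infty$ and $\mathrm{Char}(f)=(h_1,\dots,h_s)$. If $i_0(g,X)=n$ and $i_0(f,g)>n\,q_s$, then $g$ is irreducible and $\mathrm{Char}(g)=\mathrm{Char}(f)$.
   Context: $\mathbb{K}$ is an algebraically closed field of characteristic zero and $X,Y$ are single variables. $i_0(f,g)=\dim_{\mathbb{K}}\mathbb{K}[[X,Y]]/\langle f,g\rangle$. By the Weierstrass preparation theorem, if $i_0(f,X)<\infty$ then $f=u_ff_1$ with $u_f(0)\ne0$ and $f_1\in\mathbb{K}[[X]][Y]$ a Weierstrass polynomial (monic in $Y$, non-leading coefficients vanishing at $0$), of degree $i_0(f,X)$. For irreducible $f$, $f_1$ is irreducible in $\mathbb{K}[[X]][Y]$, its roots are Puiseux series, and $\mathrm{Char}(f)$ denotes the characteristic of $f_1$: the increasing sequence $h_1<\dots<h_s$ of orders $\mathrm{ord}(\alpha-\alpha')$ for distinct roots $\alpha,\alpha'$ of $f_1$. With $M_0=\mathbb{Z}$, $M_i=\mathbb{Z}+\mathbb{Z}h_1+\dots+\mathbb{Z}h_i$, $n_i=[M_i:M_{i-1}]$, $n_{s+1}=1$, $e_i=n_{i+1}\cdots n_{s+1}$, one sets $q_s=\sum_{j=1}^{s}(e_{j-1}-e_j)h_j+e_sh_s$. *)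

theory Defs
  imports "HOL-Computational_Algebra.Computational_Algebra" "HOL-Library.Extended_Nat"
begin

text \<open>Two-variable power series K[[X,Y]] are modelled as 'a fps fps:
  the outer series variable is Y, the coefficients are series in X.
  So h = sum_j (h $ j) Y^j with h $ j in K[[X]].\<close>

definition bconst :: "'a::comm_ring_1 \<Rightarrow> 'a fps fps" where
  "bconst c = fps_const (fps_const c)"

definition varX :: "'a::comm_ring_1 fps fps" where
  "varX = fps_const fps_X"

definition in_ideal2 :: "'a::comm_ring_1 fps fps \<Rightarrow> 'a fps fps \<Rightarrow> 'a fps fps \<Rightarrow> bool" where
  "in_ideal2 f g h \<longleftrightarrow> (\<exists>a b. h = a * f + b * g)"

definition indep_mod :: "'a::comm_ring_1 fps fps \<Rightarrow> 'a fps fps \<Rightarrow> nat \<Rightarrow> (nat \<Rightarrow> 'a fps fps) \<Rightarrow> bool" where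
  "indep_mod f g k b \<longleftrightarrow>
     (\<forall>c::nat \<Rightarrow> 'a. in_ideal2 f g (\<Sum>i<k. bconst (c i) * b i) \<longrightarrow> (\<forall>i<k. c i = 0))"

text \<open>i_0(f,g) = dim_K K[[X,Y]]/(f,g), as an extended natural number.\<close>
definition i0 :: "'a::comm_ring_1 fps fps \<Rightarrow> 'a fps fps \<Rightarrow> enat" where
  "i0 f g = (SUP k \<in> {k. \<exists>b. indep_mod f g k b}. enat k)"

definition weierstrass_poly :: "'a::comm_ring_1 fps poly \<Rightarrow> bool" where
  "weierstrass_poly p \<longleftrightarrow> lead_coeff p = 1 \<and> (\<forall>i<degree p. coeff p i $ 0 = 0)"

definition weierstrass_part :: "'a::comm_ring_1 fps fps \<Rightarrow> 'a fps poly" where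
  "weierstrass_part f = (THE p. weierstrass_poly p \<and> (\<exists>u. u $ 0 $ 0 \<noteq> 0 \<and> f = u * fps_of_poly p))"

text \<open>Puiseux roots of p in K[[X^(1/m)]]: alpha(t) with p(t^m, alpha(t)) = 0, t = X^(1/m).\<close>
definition puiseux_root :: "'a::field fps poly \<Rightarrow> nat \<Rightarrow> 'a fps \<Rightarrow> bool" where
  "puiseux_root p m \<alpha> \<longleftrightarrow> m > 0 \<and> poly (map_poly (\<lambda>c. fps_compose c (fps_X ^ m)) p) \<alpha> = 0"

definition char_set :: "'a::field fps poly \<Rightarrow> rat set" where
  "char_set p = {of_nat (subdegree (\<alpha> - \<beta>)) / of_nat m | m \<alpha> \<beta>.
      puiseux_root p m \<alpha> \<and> puiseux_root p m \<beta> \<and> \<alpha> \<noteq> \<beta>}"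

definition Char :: "'a::field fps fps \<Rightarrow> rat list" where
  "Char f = sorted_list_of_set (char_set (weierstrass_part f))"

definition Mgrp :: "rat list \<Rightarrow> nat \<Rightarrow> rat set" where
  "Mgrp h i = {of_int k0 + (\<Sum>j<i. of_int (k j) * h ! j) | k0 k. True}"

definition subgroup_index :: "rat set \<Rightarrow> rat set \<Rightarrow> nat" where
  "subgroup_index M M' = card ((\<lambda>x. (\<lambda>y. x + y) ` M') ` M)"

definition nidx :: "rat list \<Rightarrow> nat \<Rightarrow> nat" where
  "nidx h i = (if 1 \<le> i \<and> i \<le> length h then subgroup_index (Mgrp h i) (Mgrp h (i - 1)) else 1)"

definition eidx :: "rat list \<Rightarrow> nat \<Rightarrow> nat" where
  "eidx h i = (\<Prod>j\<in>{i+1..length h + 1}. nidx h j)"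

definition qs :: "rat list \<Rightarrow> rat" where
  "qs h = (if h = [] then 0 else (\<Sum>j\<in>{1..length h}. (of_nat (eidx h (j - 1)) - of_nat (eidx h j)) * h ! (j - 1))
          + of_nat (eidx h (length h)) * h ! (length h - 1))"

end

theory Submission
  imports Defs
begin

text \<open>Write \<open>f = u * f1\<close> and \<open>g = v * g1\<close> with Weierstrass polynomials of degree \<open>n\<close> and let
  \<open>X = t^m\<close> split both. Weierstrass division and the filtration of \<open>K[[t]][Y]\<close> by the roots \<open>\<beta>\<close> of
  \<open>g1\<close> give \<open>m * i0 f g \<le> (\<Sum>\<beta>. ord (f1 \<beta>))\<close>, so some \<open>\<beta>\<close> has \<open>ord (f1 \<beta>) > m * qs\<close>. As \<open>m * qs\<close>
  is the sum of the contacts of a root \<open>\<alpha>\<close> of \<open>f1\<close> with its conjugates plus the largest of them, \<open>\<beta>\<close>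
  agrees with some \<open>\<alpha>\<close> beyond the last characteristic exponent. Hence \<open>\<beta>\<close> has at least \<open>n\<close> conjugates
  under the \<open>m\<close>-th roots of unity: they are all the roots of \<open>g1\<close>, and their mutual contacts are those
  of the conjugates of \<open>\<alpha>\<close>.\<close>

section \<open>Weierstrass division and preparation\<close>

text \<open>Only an upper bound for \<open>i0 f g\<close> is needed: if all \<open>n\<close> roots
  \<beta> of \<open>g1\<close> had \<open>ord (f1 \<beta>) \<le> m * qs\<close>, then
  \<open>m * i0 f g \<le> n * m * qs\<close>, against the hypothesis. As \<open>i0\<close> is a
  supremum over independent families, the bound means exhibiting a linear relation in every family
  that is too large. The factor \<open>m\<close> is the rank of \<open>K[[t]]\<close> over
  \<open>K[[X]]\<close>. The obstacle is that \<open>g\<close> is not known to be irreducible: its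
  roots might be repeated or fill several orbits. Hence Puiseux's theorem is proved for all monic
  polynomials, and the roots of \<open>g1\<close> are kept in a list. Irreducibility of
  \<open>f\<close> makes the roots of \<open>f1\<close> a single orbit under
  \<open>t \<mapsto> z t\<close>. In \<open>qs\<close>, the number \<open>e_(j-1) - e_j\<close>
  counts the conjugates having contact \<open>h_j\<close> with a given root, and
  \<open>e_s = 1\<close>, so the last summand is one further copy of the largest contact.
  Irreducibility of \<open>g\<close> comes from the same orbit count: a factor of \<open>g1\<close>
  that vanishes at \<beta> already has degree \<open>n\<close>.\<close>

definition y_regular :: "'a::comm_ring_1 fps fps \<Rightarrow> nat \<Rightarrow> bool" where
  "y_regular f n \<longleftrightarrow> (\<forall>j<n. f $ j $ 0 = 0) \<and> f $ n $ 0 \<noteq> 0"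

lemma fps2_unit_iff:
  fixes u :: "'a::field fps fps"
  shows "u dvd 1 \<longleftrightarrow> u $ 0 $ 0 \<noteq> 0"
proof
  assume "u dvd 1"
  then obtain v where "1 = u * v" by (elim dvdE)
  then have "u $ 0 $ 0 * v $ 0 $ 0 = 1"
    by (metis fps_mult_nth_0 fps_one_nth)
  then show "u $ 0 $ 0 \<noteq> 0" by auto
next
  assume "u $ 0 $ 0 \<noteq> 0"
  then have "u $ 0 dvd 1" by simp
  then obtain y where "1 = u $ 0 * y" by (elim dvdE)
  then have "u * fps_right_inverse u y = 1"
    by (intro fps_right_inverse) simp
  then show "u dvd 1" by (metis dvd_triv_left)
qed

lemma fps2_mult_nth_nth:
  fixes Z W :: "'a::comm_ring_1 fps fps"
  shows "(Z * W) $ j $ k = (\<Sum>i\<le>j. \<Sum>l\<le>k. Z $ i $ l * W $ (j - i) $ (k - l))"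
  by (simp add: fps_mult_nth fps_sum_nth atLeast0AtMost)

text \<open>The coefficient of \<open>Y^j X^k\<close> in the solution \<open>Z\<close> of
  \<open>Z + X * shift(Z W) = T\<close>. The shift refers to higher \<open>Y\<close>-degrees, but
  the factor \<open>X\<close> lets in only \<open>X\<close>-degrees \<open>l < k\<close>, so the
  recursion terminates on \<open>k\<close> alone.\<close>

function shift_fix_coeff ::
    "nat \<Rightarrow> (nat \<Rightarrow> nat \<Rightarrow> 'a::comm_ring_1) \<Rightarrow> (nat \<Rightarrow> nat \<Rightarrow> 'a) \<Rightarrow> nat \<Rightarrow> nat \<Rightarrow> 'a" where
  "shift_fix_coeff n T W k j = T j k -
     (\<Sum>i\<le>j + n. \<Sum>l<k. shift_fix_coeff n T W l i * W (j + n - i) (k - 1 - l))"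
  by pat_completeness auto
termination
  by (relation "measure (\<lambda>(n, T, W, k, j). k)") auto

declare shift_fix_coeff.simps [simp del]

lemma varX_mult_nth_nth:
  fixes h :: "'a::comm_ring_1 fps fps"
  shows "(varX * h) $ j $ k = (if k = 0 then 0 else h $ j $ (k - 1))"
  by (simp add: varX_def)

lemma varX_shift_mult_nth_nth:
  fixes Z W :: "'a::comm_ring_1 fps fps"
  shows "(varX * fps_shift n (Z * W)) $ j $ k =
           (\<Sum>i\<le>j + n. \<Sum>l<k. Z $ i $ l * W $ (j + n - i) $ (k - 1 - l))"
proof (cases k)
  case (Suc k')
  then show ?thesis
    by (simp only: varX_mult_nth_nth) (simp add: fps2_mult_nth_nth lessThan_Suc_atMost)
qed (simp add: varX_mult_nth_nth)

lemma shift_fix_exists: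
  fixes T W :: "'a::comm_ring_1 fps fps"
  shows "\<exists>Z. Z + varX * fps_shift n (Z * W) = T"
proof
  let ?c = "shift_fix_coeff n (\<lambda>j k. T $ j $ k) (\<lambda>j k. W $ j $ k)"
  let ?Z = "Abs_fps (\<lambda>j. Abs_fps (\<lambda>k. ?c k j))"
  show "?Z + varX * fps_shift n (?Z * W) = T"
  proof (intro fps_ext)
    fix j k
    show "(?Z + varX * fps_shift n (?Z * W)) $ j $ k = T $ j $ k"
      by (simp only: fps_add_nth varX_shift_mult_nth_nth fps_nth_Abs_fps)
         (subst shift_fix_coeff.simps, simp)
  qed
qed

lemma shift_fix_unique:
  fixes Z W :: "'a::comm_ring_1 fps fps"
  assumes "Z + varX * fps_shift n (Z * W) = 0"
  shows "Z = 0"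
proof (intro fps_ext)
  fix j k
  show "Z $ j $ k = 0 $ j $ k"
  proof (induction k arbitrary: j rule: less_induct)
    case (less k)
    have "0 = (Z + varX * fps_shift n (Z * W)) $ j $ k"
      using assms by simp
    also have "\<dots> = Z $ j $ k"
      by (simp add: varX_shift_mult_nth_nth less)
    finally show ?case by simp
  qed
qed

text \<open>Splitting off the unit \<open>U\<close> from a regular series turns division by it into a fixed point
  equation for \<open>Z = q * U\<close> that is contracting for the \<open>X\<close>-adic topology.\<close>
lemma y_regular_split:
  fixes g :: "'a::field fps fps"
  assumes "y_regular g n"
  obtains U V W where "U * V = 1"
    "\<And>q. fps_shift n (q * g) = q * U + varX * fps_shift n (q * U * W)"
proof -
  define U where "U = fps_shift n g"
  define A where "A = fps_cutoff n g"
  have gUA: "g = U * fps_X ^ n + A"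
    by (simp add: U_def A_def fps_shift_cutoff)
  have "U $ 0 $ 0 \<noteq> 0"
    using assms by (simp add: U_def y_regular_def)
  then obtain V where UV: "U * V = 1"
    by (metis fps2_unit_iff dvdE)
  have A0: "A $ j $ 0 = 0" for j
    using assms by (simp add: A_def y_regular_def)
  define W where "W = Abs_fps (\<lambda>j. fps_shift 1 ((A * V) $ j))"
  have "(A * V) $ j $ 0 = 0" for j
    by (simp add: fps_mult_nth fps_sum_nth A0)
  then have W: "A * V = varX * W"
    by (intro fps_ext, subst varX_mult_nth_nth) (simp add: W_def)
  have "fps_shift n (q * g) = q * U + varX * fps_shift n (q * U * W)" for q
  proof -
    have "q * g = q * U * fps_X ^ n + q * (U * V) * A"
      by (simp add: gUA UV algebra_simps)
    also have "q * (U * V) * A = q * U * (A * V)"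
      by (simp only: ac_simps)
    also have "\<dots> = varX * (q * U * W)"
      unfolding W by (simp only: ac_simps)
    finally have "fps_shift n (q * g) = q * U + fps_shift n (varX * (q * U * W))"
      by (simp add: fps_shift_add)
    also have "fps_shift n (varX * (q * U * W)) = varX * fps_shift n (q * U * W)"
      by (intro fps_ext) (simp add: varX_mult_nth_nth)
    finally show ?thesis .
  qed
  with UV show thesis by (rule that)
qed

lemma fps_shift_eq_0_imp_poly:
  fixes h :: "'a::comm_ring_1 fps"
  assumes "fps_shift n h = 0"
  obtains r where "h = fps_of_poly r" "\<forall>j\<ge>n. coeff r j = 0"
proof -
  define r where "r = Poly (map (fps_nth h) [0..<n])"
  have "h $ j = 0" if "j \<ge> n" for j
    using arg_cong[OF assms, of "\<lambda>f. f $ (j - n)"] that by simp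
  then have "h = fps_of_poly r"
    by (intro fps_ext) (auto simp: r_def nth_default_def)
  moreover have "\<forall>j\<ge>n. coeff r j = 0"
    by (simp add: r_def nth_default_def)
  ultimately show thesis by (rule that)
qed

text \<open>Dividing means choosing \<open>q\<close> so that \<open>h - q g\<close> has no terms of
  \<open>Y\<close>-degree at least \<open>n\<close>. For \<open>Z = q U\<close> this is the fixed
  point equation of \<open>shift_fix_exists\<close>, and \<open>q = Z V\<close> recovers the
  quotient.\<close>

lemma weierstrass_division:
  fixes g h :: "'a::field fps fps"
  assumes "y_regular g n"
  obtains q r where "h = q * g + fps_of_poly r" "\<forall>j\<ge>n. coeff r j = 0"
proof -
  obtain U V W where UV: "U * V = 1"
    and *: "\<And>q. fps_shift n (q * g) = q * U + varX * fps_shift n (q * U * W)"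
    using y_regular_split[OF assms] by metis
  obtain Z where Z: "Z + varX * fps_shift n (Z * W) = fps_shift n h"
    using shift_fix_exists by blast
  have "Z * V * U = Z * (U * V)"
    by (simp only: ac_simps)
  then have "Z * V * U = Z"
    using UV by simp
  then have "fps_shift n (h - Z * V * g) = 0"
    unfolding fps_shift_diff * by (simp only: Z diff_self)
  then obtain r where "h - Z * V * g = fps_of_poly r" "\<forall>j\<ge>n. coeff r j = 0"
    by (rule fps_shift_eq_0_imp_poly)
  then show thesis
    by (intro that[of "Z * V" r]) (auto simp: algebra_simps)
qed

lemma weierstrass_division_unique:
  fixes g :: "'a::field fps fps"
  assumes "y_regular g n" and eq: "q * g = fps_of_poly r" and r: "\<forall>j\<ge>n. coeff r j = 0"
  shows "q = 0" "r = 0"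
proof -
  obtain U V W where UV: "U * V = 1"
    and *: "\<And>q. fps_shift n (q * g) = q * U + varX * fps_shift n (q * U * W)"
    using y_regular_split[OF assms(1)] by metis
  have "fps_shift n (q * g) = 0"
    unfolding eq by (intro fps_ext) (use r in simp)
  then have "q * U = 0"
    unfolding * by (rule shift_fix_unique)
  then have "q * (U * V) = 0"
    by (metis mult.assoc mult_zero_left)
  then show "q = 0"
    by (simp add: UV)
  then show "r = 0"
    using eq by (metis fps_of_poly_0 fps_of_poly_eq_iff mult_zero_left)
qed

lemma y_regular_mult:
  fixes f g :: "'a::idom fps fps"
  assumes "y_regular f m" "y_regular g n"
  shows "y_regular (f * g) (m + n)"
proof -
  have F: "f $ i $ 0 = 0" if "i < m" for i using that assms(1) by (simp add: y_regular_def)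
  have G: "g $ i $ 0 = 0" if "i < n" for i using that assms(2) by (simp add: y_regular_def)
  have "(f * g) $ j $ 0 = 0" if "j < m + n" for j
  proof -
    have "f $ i $ 0 * g $ (j - i) $ 0 = 0" if "i \<le> j" for i
      using F[of i] G[of "j - i"] that \<open>j < m + n\<close> by (cases "i < m") auto
    then show ?thesis
      by (simp add: fps_mult_nth fps_sum_nth del: mult_eq_0_iff)
  qed
  moreover have "(f * g) $ (m + n) $ 0 \<noteq> 0"
  proof -
    have "(\<Sum>i=0..m + n. f $ i $ 0 * g $ (m + n - i) $ 0) =
          (\<Sum>i\<in>{m}. f $ i $ 0 * g $ (m + n - i) $ 0)"
    proof (intro sum.mono_neutral_right ballI)
      fix i assume "i \<in> {0..m + n} - {m}"
      then have "i < m \<or> m + n - i < n" by auto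
      then show "f $ i $ 0 * g $ (m + n - i) $ 0 = 0"
        using F[of i] G[of "m + n - i"] by auto
    qed auto
    then show ?thesis
      using assms by (simp add: fps_mult_nth fps_sum_nth y_regular_def)
  qed
  ultimately show ?thesis by (simp add: y_regular_def)
qed

lemma y_regular_unique: "y_regular f m \<Longrightarrow> y_regular f n \<Longrightarrow> m = n"
  unfolding y_regular_def by (meson linorder_neqE_nat)

lemma y_regular_0_iff: "y_regular f 0 \<longleftrightarrow> f $ 0 $ 0 \<noteq> 0"
  by (simp add: y_regular_def)

lemma weierstrass_poly_imp_y_regular:
  "weierstrass_poly p \<Longrightarrow> y_regular (fps_of_poly p) (degree p)"
  by (simp add: weierstrass_poly_def y_regular_def)

text \<open>Divide \<open>Y^n\<close> by \<open>f\<close>: then \<open>Y^n - r = q f\<close> is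
  monic of degree \<open>n\<close>. At \<open>X = 0\<close> its lower coefficients vanish because
  \<open>f(0,Y)\<close> has order \<open>n\<close>, and comparing the coefficients of
  \<open>Y^n\<close> there shows that \<open>q\<close> is a unit, with inverse
  \<open>u\<close>.\<close>

lemma weierstrass_preparation:
  fixes f :: "'a::field fps fps"
  assumes f: "y_regular f n"
  obtains u p where "weierstrass_poly p" "degree p = n" "u $ 0 $ 0 \<noteq> 0" "f = u * fps_of_poly p"
proof -
  obtain q r where qr: "fps_X ^ n = q * f + fps_of_poly r" "\<forall>j\<ge>n. coeff r j = 0"
    using weierstrass_division[OF f] by blast
  define p where "p = monom 1 n - r"
  have p: "fps_of_poly p = q * f"
    using qr(1) by (simp add: p_def fps_of_poly_diff fps_of_poly_monom')
  have "coeff p n = 1" and high: "\<forall>j>n. coeff p j = 0"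
    using qr(2) by (auto simp: p_def)
  then have deg: "degree p = n"
    by (metis degree_le le_antisym le_degree zero_neq_one)
  have F: "f $ i $ 0 = 0" if "i < n" for i using that f by (simp add: y_regular_def)
  have p0: "coeff p j $ 0 = (\<Sum>i=0..j. q $ i $ 0 * f $ (j - i) $ 0)" for j
    using arg_cong[OF p, of "\<lambda>h. h $ j $ 0"] by (simp add: fps_mult_nth fps_sum_nth)
  have "coeff p j $ 0 = 0" if "j < n" for j
    unfolding p0 using that F by (intro sum.neutral) auto
  then have w: "weierstrass_poly p"
    using deg \<open>coeff p n = 1\<close> by (simp add: weierstrass_poly_def)
  have "coeff p n $ 0 = (\<Sum>i\<in>{0}. q $ i $ 0 * f $ (n - i) $ 0)"
    unfolding p0 by (rule sum.mono_neutral_right) (auto simp: F)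
  then have "q $ 0 $ 0 \<noteq> 0"
    using \<open>coeff p n = 1\<close> by auto
  then obtain u where u: "1 = q * u"
    by (metis fps2_unit_iff dvdE)
  have "q $ 0 $ 0 * u $ 0 $ 0 = 1"
    using u by (metis fps_mult_nth_0 fps_one_nth)
  then have "u $ 0 $ 0 \<noteq> 0" by auto
  moreover have "u * fps_of_poly p = (q * u) * f"
    unfolding p by (simp only: ac_simps)
  then have "f = u * fps_of_poly p"
    by (simp flip: u)
  ultimately show thesis using that w deg by blast
qed

text \<open>Both polynomials are unit multiples of \<open>f\<close> and monic of the same degree, so
  their difference is a multiple of \<open>f\<close> of smaller degree; uniqueness of division by
  \<open>f\<close> makes it zero. This justifies the \<open>THE\<close> in
  \<open>weierstrass_part\<close>.\<close>

lemma weierstrass_poly_unique: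
  fixes p p' :: "'a::field fps poly"
  assumes p: "weierstrass_poly p" "u $ 0 $ 0 \<noteq> 0" "f = u * fps_of_poly p"
    and p': "weierstrass_poly p'" "u' $ 0 $ 0 \<noteq> 0" "f = u' * fps_of_poly p'"
  shows "p = p'"
proof -
  have f: "y_regular f (degree p)" "y_regular f (degree p')"
    using y_regular_mult[OF _ weierstrass_poly_imp_y_regular[OF p(1)], of u 0]
      y_regular_mult[OF _ weierstrass_poly_imp_y_regular[OF p'(1)], of u' 0] p p'
    by (simp_all add: y_regular_0_iff)
  then have deg: "degree p = degree p'"
    by (rule y_regular_unique)
  obtain v v' where v: "1 = u * v" "1 = u' * v'"
    using p(2) p'(2) by (metis fps2_unit_iff dvdE)
  have "v * f = (u * v) * fps_of_poly p"
    unfolding p(3) by (simp only: ac_simps)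
  moreover have "v' * f = (u' * v') * fps_of_poly p'"
    unfolding p'(3) by (simp only: ac_simps)
  ultimately have "fps_of_poly p = v * f" "fps_of_poly p' = v' * f"
    by (simp_all flip: v)
  then have "(v - v') * f = fps_of_poly (p - p')"
    by (simp add: fps_of_poly_diff algebra_simps)
  moreover have "\<forall>j\<ge>degree p. coeff (p - p') j = 0"
    using p(1) p'(1) deg by (auto simp: weierstrass_poly_def coeff_eq_0 le_less)
  ultimately have "p - p' = 0"
    using f(1) weierstrass_division_unique(2) by blast
  then show ?thesis by simp
qed

lemma weierstrass_part_eqI:
  fixes p :: "'a::field fps poly"
  assumes "weierstrass_poly p" "u $ 0 $ 0 \<noteq> 0" "f = u * fps_of_poly p"
  shows "weierstrass_part f = p"
  unfolding weierstrass_part_def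
  using assms weierstrass_poly_unique by (intro the_equality) blast+

section \<open>Puiseux's theorem\<close>

lemma monic_division:
  fixes p w :: "'a::idom poly"
  assumes "lead_coeff w = 1"
  obtains q r where "p = q * w + r" "\<forall>j\<ge>degree w. coeff r j = 0"
proof -
  obtain q r where qr: "pseudo_divmod p w = (q, r)" by fastforce
  have "w \<noteq> 0" using assms by auto
  from pseudo_divmod[OF this qr] show thesis
    by (intro that[of q r]) (auto simp: assms mult.commute coeff_eq_0)
qed

text \<open>Expanding \<open>(Y + c)^(n+1)\<close> adds \<open>(n+1) c\<close> to the second highest
  coefficient. In characteristic zero a suitable \<open>c\<close> removes this coefficient: the
  Tschirnhaus transformation, used for Puiseux's theorem.\<close>

lemma coeff_pcompose_shift_pred_degree:
  fixes p :: "'a::idom poly"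
  assumes "lead_coeff p = 1" "degree p = Suc n"
  shows "coeff (pcompose p [:c, 1:]) n = coeff p n + of_nat (Suc n) * c"
  using assms
proof (induction p arbitrary: n)
  case (pCons a q)
  have q: "lead_coeff q = 1" "degree q = n"
    using pCons.prems by (auto split: if_splits)
  have lc: "coeff (pcompose q [:c, 1:]) n = 1"
    using lead_coeff_comp[of "[:c, 1:]" q] q by (simp add: degree_pcompose)
  show ?case
  proof (cases n)
    case 0
    then show ?thesis using lc q by (simp add: pcompose_pCons)
  next
    case (Suc k)
    then show ?thesis
      using lc q pCons.IH[of k] by (simp add: pcompose_pCons algebra_simps)
  qed
qed simp

lemma monic_pcompose_shift:
  fixes p :: "'a::idom poly"
  assumes "lead_coeff p = 1"
  shows "degree (pcompose p [:c, 1:]) = degree p" "lead_coeff (pcompose p [:c, 1:]) = 1"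
  using assms by (simp add: degree_pcompose, subst lead_coeff_comp) auto

lemma pcompose_shift_shift:
  fixes p :: "'a::idom poly"
  shows "pcompose (pcompose p [:c, 1:]) [:- c, 1:] = p"
proof -
  have "pcompose [:c, 1:] [:- c, 1:] = [:0, 1:]"
    by (simp add: pcompose_pCons)
  then show ?thesis by (simp flip: pcompose_assoc)
qed

lemma poly_eq_monom_iff:
  assumes "lead_coeff p = 1" "degree p = n"
  shows "p = monom 1 n \<longleftrightarrow> (\<forall>i<n. coeff p i = 0)"
proof
  assume "\<forall>i<n. coeff p i = 0"
  then show "p = monom 1 n"
    using assms by (intro poly_eqI) (metis coeff_eq_0 coeff_monom linorder_neqE_nat)
qed auto

lemma monic_factorD:
  fixes p q r :: "'a::idom poly"
  assumes "lead_coeff (q * r) = 1" "lead_coeff r = 1"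
  shows "lead_coeff q = 1" "degree (q * r) = degree q + degree r"
  using assms by (simp add: lead_coeff_mult, subst degree_mult_eq) auto

section \<open>Ring homomorphisms on coefficients, ramification \<open>X = t^m\<close> and
  splitting\<close>

locale comm_ring_map =
  fixes \<phi> :: "'a::idom \<Rightarrow> 'b::idom"
  assumes map_add: "\<phi> (x + y) = \<phi> x + \<phi> y"
    and map_mult: "\<phi> (x * y) = \<phi> x * \<phi> y"
    and map_one: "\<phi> 1 = 1"
begin

lemma map_zero: "\<phi> 0 = 0"
  using map_add[of 0 0] by (metis add_cancel_right_right add_0)

lemma map_minus: "\<phi> (- x) = - \<phi> x"
  using map_add[of x "- x"] by (simp add: map_zero eq_neg_iff_add_eq_0 add.commute)

lemma map_sum: "\<phi> (sum f A) = (\<Sum>x\<in>A. \<phi> (f x))"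
  by (induction A rule: infinite_finite_induct) (auto simp: map_zero map_add)

lemma map_poly_add: "map_poly \<phi> (p + q) = map_poly \<phi> p + map_poly \<phi> q"
  by (intro poly_eqI) (simp add: coeff_map_poly map_zero map_add)

lemma map_poly_mult: "map_poly \<phi> (p * q) = map_poly \<phi> p * map_poly \<phi> q"
  by (intro poly_eqI) (simp add: coeff_map_poly map_zero map_sum map_mult coeff_mult)

lemma map_poly_prod: "map_poly \<phi> (prod f A) = (\<Prod>x\<in>A. map_poly \<phi> (f x))"
  by (induction A rule: infinite_finite_induct) (auto simp: map_one map_poly_mult)

lemma map_poly_prod_list: "map_poly \<phi> (prod_list ps) = prod_list (map (map_poly \<phi>) ps)"
  by (induction ps) (auto simp: map_one map_poly_mult)

lemma map_poly_linear: "map_poly \<phi> [:a, 1:] = [:\<phi> a, 1:]"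
  by (simp add: map_poly_pCons map_zero map_one)

lemma map_poly_pcompose: "map_poly \<phi> (pcompose p q) = pcompose (map_poly \<phi> p) (map_poly \<phi> q)"
  by (induction p) (simp_all add: pcompose_pCons map_poly_pCons map_zero map_poly_add map_poly_mult)

lemma poly_map_poly: "poly (map_poly \<phi> p) (\<phi> x) = \<phi> (poly p x)"
  by (induction p) (simp_all add: map_poly_pCons map_zero map_add map_mult)

lemma degree_map_poly_monic: "lead_coeff p = 1 \<Longrightarrow> degree (map_poly \<phi> p) = degree p"
  by (intro map_poly_degree_eq) (simp add: map_one)

lemma lead_coeff_map_poly_monic: "lead_coeff p = 1 \<Longrightarrow> lead_coeff (map_poly \<phi> p) = 1"
  by (simp add: degree_map_poly_monic coeff_map_poly map_zero map_one)

end

interpretation fps_nth_0: comm_ring_map "\<lambda>c :: 'a::idom fps. c $ 0"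
  by unfold_locales simp_all

definition ramify :: "nat \<Rightarrow> 'a::comm_ring_1 fps \<Rightarrow> 'a fps" where
  "ramify m c = fps_compose c (fps_X ^ m)"

lemma ramify_nth:
  assumes "m > 0"
  shows "ramify m c $ k = (if m dvd k then c $ (k div m) else 0)"
proof -
  have "ramify m c $ k = (\<Sum>i=0..k. if k = m * i then c $ i else 0)"
    by (simp add: ramify_def fps_compose_nth if_distrib cong: if_cong flip: power_mult)
  also have "\<dots> = (\<Sum>i\<in>(if m dvd k then {k div m} else {}). if k = m * i then c $ i else 0)"
    using assms by (intro sum.mono_neutral_right) (auto simp: dvd_def)
  finally show ?thesis by auto
qed

lemma ramify_0 [simp]: "ramify m 0 = 0" and ramify_1 [simp]: "ramify m 1 = 1"
  by (simp_all add: ramify_def)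

lemma ramify_comm_ring_map: "m > 0 \<Longrightarrow> comm_ring_map (ramify m :: 'a::idom fps \<Rightarrow> _)"
  by unfold_locales (simp_all add: ramify_def fps_compose_add_distrib fps_compose_mult_distrib)

lemma ramify_ramify: "m > 0 \<Longrightarrow> k > 0 \<Longrightarrow> ramify k (ramify m c) = ramify (m * k) c"
  by (intro fps_ext) (auto simp: ramify_nth div_mult2_eq mult.commute[of m] dvd_div_iff_mult dvd_mult_left
    elim: dvd_mult_right)

lemma map_poly_ramify_ramify:
  fixes p :: "'a::idom fps poly"
  assumes "m > 0" "k > 0"
  shows "map_poly (ramify k) (map_poly (ramify m) p) = map_poly (ramify (m * k)) p"
  using assms
  by (intro poly_eqI)
     (simp add: coeff_map_poly ramify_ramify)

lemma subdegree_ramify: "m > 0 \<Longrightarrow> subdegree (ramify m (c :: 'a::idom fps)) = subdegree c * m"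
  by (simp add: ramify_def)

lemma ramify_eq_0_iff: "m > 0 \<Longrightarrow> ramify m (c :: 'a::idom fps) = 0 \<longleftrightarrow> c = 0"
  by (simp add: ramify_def fps_compose_eq_0_iff)

definition splits :: "nat \<Rightarrow> 'a::idom fps poly \<Rightarrow> 'a fps list \<Rightarrow> bool" where
  "splits m p bs \<longleftrightarrow> m > 0 \<and> map_poly (ramify m) p = (\<Prod>\<beta>\<leftarrow>bs. [:- \<beta>, 1:])"

lemma splits_ramify:
  assumes "splits m p bs" "k > 0"
  shows "splits (m * k) p (map (ramify k) bs)"
proof -
  interpret ram: comm_ring_map "ramify k :: 'a fps \<Rightarrow> _"
    using assms(2) by (rule ramify_comm_ring_map)
  have "map_poly (ramify (m * k)) p = map_poly (ramify k) (map_poly (ramify m) p)"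
    using assms map_poly_ramify_ramify[of m k p] by (simp add: splits_def)
  also have "\<dots> = map_poly (ramify k) (\<Prod>\<beta>\<leftarrow>bs. [:- \<beta>, 1:])"
    using assms by (simp add: splits_def)
  also have "\<dots> = (\<Prod>\<beta>\<leftarrow>bs. map_poly (ramify k) [:- \<beta>, 1:])"
    by (simp only: ram.map_poly_prod_list list.map_comp o_def)
  finally show ?thesis
    using assms by (simp add: splits_def ram.map_poly_linear ram.map_minus o_def)
qed

lemma splits_mult:
  assumes "splits m p bs" "splits m q cs"
  shows "splits m (p * q) (bs @ cs)"
  using assms comm_ring_map.map_poly_mult[OF ramify_comm_ring_map[of m], of p q]
  by (simp add: splits_def)

lemma splits_shift:
  assumes "splits m (pcompose p [:c, 1:]) bs"
  shows "splits m p (map (\<lambda>\<beta>. \<beta> + ramify m c) bs)"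
proof -
  have m: "m > 0" using assms by (simp add: splits_def)
  then interpret ram: comm_ring_map "ramify m :: 'a fps \<Rightarrow> _"
    by (rule ramify_comm_ring_map)
  have "map_poly (ramify m) p = map_poly (ramify m) (pcompose (pcompose p [:c, 1:]) [:- c, 1:])"
    by (simp add: pcompose_shift_shift)
  also have "\<dots> = pcompose (\<Prod>\<beta>\<leftarrow>bs. [:- \<beta>, 1:]) [:- ramify m c, 1:]"
    using assms
    by (subst ram.map_poly_pcompose) (simp add: splits_def ram.map_poly_linear ram.map_minus)
  also have "\<dots> = (\<Prod>\<beta>\<leftarrow>bs. [:- (\<beta> + ramify m c), 1:])"
  proof (induction bs)
    case (Cons b bs)
    have "pcompose [:- b, 1:] [:- ramify m c, 1:] = [:- (b + ramify m c), 1:]"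
      by (simp add: pcompose_pCons)
    with Cons show ?case
      by (simp add: pcompose_mult del: mult_pCons_left)
  qed (simp add: pcompose_1)
  finally show ?thesis using m by (simp add: splits_def o_def)
qed

lemma degree_prod_list_linear:
  fixes bs :: "'a::idom list"
  shows "degree (\<Prod>\<beta>\<leftarrow>bs. [:- \<beta>, 1:]) = length bs"
  by (induction bs) (simp, simp del: mult_pCons_left, subst degree_mult_eq, auto simp: prod_list_zero_iff)

text \<open>The coefficient relation says \<open>P(x Y) = x^n Q(Y)\<close>, so the roots of
  \<open>P\<close> are \<open>x\<close> times those of \<open>Q\<close>. The substitution of
  \<open>x Y\<close> for \<open>Y\<close> can be cancelled since
  \<open>x \<noteq> 0\<close>.\<close>

lemma linear_factors_scale:
  fixes P Q :: "'a::idom poly"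
  assumes "x \<noteq> 0" "\<And>i. i \<le> n \<Longrightarrow> coeff P i = x ^ (n - i) * coeff Q i"
    and "degree P = n" "degree Q = n" "Q = (\<Prod>\<beta>\<leftarrow>bs. [:- \<beta>, 1:])"
  shows "P = (\<Prod>\<beta>\<leftarrow>bs. [:- (x * \<beta>), 1:])"
proof -
  have "pcompose P [:0, x:] = smult (x ^ n) Q"
  proof (intro poly_eqI)
    fix i
    show "coeff (pcompose P [:0, x:]) i = coeff (smult (x ^ n) Q) i"
      using assms(2)[of i] assms(3,4)
      by (cases "i \<le> n") (simp_all add: coeff_pcompose_linear coeff_eq_0 flip: power_add mult.assoc)
  qed
  also have "\<dots> = smult (x ^ length bs) (\<Prod>\<beta>\<leftarrow>bs. [:- \<beta>, 1:])"
    using assms(4,5) degree_prod_list_linear[of bs] by simp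
  also have "\<dots> = pcompose (\<Prod>\<beta>\<leftarrow>bs. [:- (x * \<beta>), 1:]) [:0, x:]"
  proof (induction bs)
    case (Cons b bs)
    have "smult (x ^ length (b # bs)) (\<Prod>\<beta>\<leftarrow>b # bs. [:- \<beta>, 1:]) =
        smult x [:- b, 1:] * smult (x ^ length bs) (\<Prod>\<beta>\<leftarrow>bs. [:- \<beta>, 1:])"
      by (simp add: mult.commute[of "x ^ length bs"] del: mult_pCons_left mult_pCons_right smult_pCons)
    also have "smult x [:- b, 1:] = pcompose [:- (x * b), 1:] [:0, x:]"
      by (simp add: pcompose_pCons)
    finally show ?case
      by (simp only: Cons.IH list.map prod_list.Cons pcompose_mult)
  qed (simp add: pcompose_1)
  finally have "pcompose (P - (\<Prod>\<beta>\<leftarrow>bs. [:- (x * \<beta>), 1:])) [:0, x:] = 0"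
    by (simp add: pcompose_diff)
  then show ?thesis
    using assms(1) by (subst (asm) pcompose_eq_0_iff) auto
qed

text \<open>Weierstrass preparation at the root \<open>c\<close> of the reduction replaces Hensel's lemma.\<close>
lemma monic_factor_of_reduction_root:
  fixes p :: "'a::field fps poly"
  assumes monic: "lead_coeff p = 1"
    and root: "poly (map_poly (\<lambda>a. a $ 0) p) c = 0"
    and not_pow: "pcompose (map_poly (\<lambda>a. a $ 0) p) [:c, 1:] \<noteq> monom 1 (degree p)"
  obtains q r where "p = q * r" "lead_coeff q = 1" "lead_coeff r = 1"
    "degree q < degree p" "degree r < degree p"
proof -
  define P where "P = pcompose p [:fps_const c, 1:]"
  have deg: "degree P = degree p" and lc: "lead_coeff P = 1"
    unfolding P_def using monic by (rule monic_pcompose_shift)+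
  let ?R = "map_poly (\<lambda>a. a $ 0) P"
  have R: "?R = pcompose (map_poly (\<lambda>a. a $ 0) p) [:c, 1:]"
    by (simp add: P_def fps_nth_0.map_poly_pcompose fps_nth_0.map_poly_linear)
  have degR: "degree ?R = degree p" and lcR: "lead_coeff ?R = 1"
    using lc fps_nth_0.degree_map_poly_monic fps_nth_0.lead_coeff_map_poly_monic deg by metis+
  have coeffR: "coeff ?R i = coeff P i $ 0" for i
    by (simp add: coeff_map_poly)
  have "coeff ?R 0 = 0"
    using root unfolding R by simp
  obtain i where i: "i < degree p" "coeff ?R i \<noteq> 0"
    using not_pow poly_eq_monom_iff[OF lcR degR] R by auto
  \<comment> \<open>\<open>k\<close> is the multiplicity of the root \<open>c\<close> of the
    reduction: positive since \<open>c\<close> is a root, and below the degree since the reduction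
    is not a pure power of \<open>Y - c\<close>. So preparation yields a \<open>w\<close> of
    intermediate degree.\<close>
  define k where "k = (LEAST i. coeff ?R i \<noteq> 0)"
  have k: "coeff ?R k \<noteq> 0" unfolding k_def using i(2) by (rule LeastI)
  have "k \<le> i" unfolding k_def using i(2) by (rule Least_le)
  have "k \<noteq> 0" using k \<open>coeff ?R 0 = 0\<close> by metis
  have "coeff ?R j = 0" if "j < k" for j
    using not_less_Least[of j "\<lambda>i. coeff ?R i \<noteq> 0"] that unfolding k_def by blast
  then have "y_regular (fps_of_poly P) k"
    using k unfolding y_regular_def fps_of_poly_nth coeffR by blast
  then obtain u w where w: "weierstrass_poly w" "degree w = k" "fps_of_poly P = u * fps_of_poly w"
    by (rule weierstrass_preparation)
  have lcw: "lead_coeff w = 1" using w(1) by (simp add: weierstrass_poly_def)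
  obtain q r where qr: "P = q * w + r" "\<forall>j\<ge>degree w. coeff r j = 0"
    using monic_division[OF lcw] by blast
  \<comment> \<open>The cofactor \<open>u\<close> is a priori only a power series in
    \<open>Y\<close>. Uniqueness of Weierstrass division kills the remainder of the polynomial
    division, so \<open>w\<close> divides \<open>P\<close> as a polynomial.\<close>
  have "(u - fps_of_poly q) * fps_of_poly w = fps_of_poly r"
    using arg_cong[OF qr(1), of fps_of_poly] w(3)
    by (simp add: fps_of_poly_add fps_of_poly_mult algebra_simps)
  then have "r = 0"
    using weierstrass_division_unique(2)[OF weierstrass_poly_imp_y_regular[OF w(1)]] qr(2) by blast
  then have P: "P = q * w" using qr(1) by simp
  have q: "lead_coeff q = 1" "degree P = degree q + degree w"
    using monic_factorD[of q w] lc lcw unfolding P by simp_all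
  have "p = pcompose P [:- fps_const c, 1:]"
    unfolding P_def by (rule pcompose_shift_shift[symmetric])
  also have "\<dots> = pcompose q [:- fps_const c, 1:] * pcompose w [:- fps_const c, 1:]"
    by (simp add: P pcompose_mult)
  finally show thesis
    using monic_pcompose_shift[OF q(1), of "- fps_const c"] monic_pcompose_shift[OF lcw, of "- fps_const c"]
      q(2) w(2) \<open>k \<noteq> 0\<close> \<open>k \<le> i\<close> i(1) deg
    by (intro that) auto
qed

text \<open>If the reduction were \<open>(Y - c)^(n+1)\<close>, its vanishing trace would give
  \<open>(n+1) c = 0\<close>, hence \<open>c = 0\<close> in characteristic zero, and all lower
  coefficients would vanish at \<open>X = 0\<close>, against the choice of \<open>i\<close>.\<close>

lemma monic_factor_of_reduction_trace_0:
  fixes p :: "'a::{alg_closed_field, field_char_0} fps poly"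
  assumes monic: "lead_coeff p = 1" and deg: "degree p = Suc n"
    and trace: "coeff p n = 0" and i: "i \<le> n" "coeff p i $ 0 \<noteq> 0"
  obtains q r where "p = q * r" "lead_coeff q = 1" "lead_coeff r = 1"
    "degree q < degree p" "degree r < degree p"
proof -
  let ?R = "map_poly (\<lambda>a. a $ 0) p"
  have degR: "degree ?R = Suc n" and lcR: "lead_coeff ?R = 1"
    using monic fps_nth_0.degree_map_poly_monic fps_nth_0.lead_coeff_map_poly_monic deg by metis+
  then obtain c where c: "poly ?R c = 0"
    using alg_closed_imp_poly_has_root[of ?R] by auto
  have "pcompose ?R [:c, 1:] \<noteq> monom 1 (degree p)"
  proof
    assume *: "pcompose ?R [:c, 1:] = monom 1 (degree p)"
    have "coeff (pcompose ?R [:c, 1:]) n = of_nat (Suc n) * c"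
      using coeff_pcompose_shift_pred_degree[OF lcR degR, of c] trace by (simp add: coeff_map_poly)
    then have "of_nat (Suc n) * c = 0"
      unfolding * using deg by simp
    then have "c = 0"
      by (metis mult_eq_0_iff of_nat_eq_0_iff nat.distinct(1))
    then have "?R = monom 1 (degree p)"
      using * by simp
    then show False
      using i deg by (metis coeff_map_poly fps_zero_nth coeff_monom not_less_eq_eq order_refl)
  qed
  with monic c show thesis
    using that by (rule monic_factor_of_reduction_root)
qed

section \<open>Newton polygon rescaling and Puiseux's theorem\<close>

lemma min_slope_exists:
  fixes v :: "nat \<Rightarrow> nat"
  assumes "finite I" "I \<noteq> {}" "\<And>i. i \<in> I \<Longrightarrow> i < n"
  obtains i0 where "i0 \<in> I" "\<And>i. i \<in> I \<Longrightarrow> v i0 * (n - i) \<le> v i * (n - i0)"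
proof -
  define f where "f i = (of_nat (v i) / of_nat (n - i) :: rat)" for i
  obtain i0 where i0: "i0 \<in> I" "\<forall>i\<in>I. f i0 \<le> f i"
    using ex_min_if_finite[of "f ` I"] assms(1,2)
    by (metis (no_types, lifting) finite_imageI image_is_empty imageE image_eqI linorder_not_le)
  have "v i0 * (n - i) \<le> v i * (n - i0)" if "i \<in> I" for i
  proof -
    have "of_nat (v i0) * of_nat (n - i) \<le> (of_nat (v i) * of_nat (n - i0) :: rat)"
      using i0(1) bspec[OF i0(2) that] assms(3)[OF that] assms(3)[OF i0(1)]
      by (simp add: f_def field_simps)
    then show ?thesis
      by (metis of_nat_le_iff of_nat_mult)
  qed
  with i0(1) show thesis by (rule that)
qed

text \<open>A step along the edge of smallest slope \<open>u / v\<close> of the Newton polygon: put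
  \<open>X = t^v\<close>, \<open>Y = t^u Y'\<close> and divide by \<open>t^(u n)\<close>. Minimality
  keeps the new coefficients integral, and the one at \<open>i0\<close>, which attains the minimum,
  becomes a unit.\<close>

lemma minimal_slope_rescaling:
  fixes p :: "'a::field fps poly"
  assumes monic: "lead_coeff p = 1" and deg: "degree p = n" and p: "p \<noteq> monom 1 n"
  obtains v u p2 i0 where "v > 0" "lead_coeff p2 = 1" "degree p2 = n"
    "\<And>i. i \<le> n \<Longrightarrow> ramify v (coeff p i) = (fps_X ^ u) ^ (n - i) * coeff p2 i"
    "i0 < n" "coeff p2 i0 $ 0 \<noteq> 0"
proof -
  define I where "I = {i. i < n \<and> coeff p i \<noteq> 0}"
  have "I \<noteq> {}"
    using p poly_eq_monom_iff[OF monic deg] by (auto simp: I_def)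
  moreover have "finite I" "\<And>i. i \<in> I \<Longrightarrow> i < n"
    by (auto simp: I_def)
  ultimately obtain i0 where i0: "i0 \<in> I"
    and min: "\<And>i. i \<in> I \<Longrightarrow> subdegree (coeff p i0) * (n - i) \<le> subdegree (coeff p i) * (n - i0)"
    using min_slope_exists[where v = "\<lambda>i. subdegree (coeff p i)"] by metis
  \<comment> \<open>The fraction \<open>u / v\<close> need not be reduced: with
    \<open>v = n - i0\<close> the coefficient at \<open>i0\<close> acquires order
    \<open>u v = u (n - i0)\<close>, exactly the power of \<open>t\<close> that is divided
    out.\<close>
  define v where "v = n - i0"
  define u where "u = subdegree (coeff p i0)"
  have v: "v > 0" using i0 by (simp add: v_def I_def)
  define c where "c i = fps_shift (u * (n - i)) (ramify v (coeff p i))" for i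
  have c: "ramify v (coeff p i) = (fps_X ^ u) ^ (n - i) * c i" if "i \<le> n" for i
  proof (cases "i \<in> I")
    case True
    then have "u * (n - i) \<le> subdegree (ramify v (coeff p i))"
      unfolding subdegree_ramify[OF v] unfolding u_def v_def by (rule min)
    then show ?thesis
      by (simp add: c_def fps_shift_times_fps_X_power mult.commute[of "fps_X ^ (u * (n - i))"]
          flip: power_mult)
  next
    case False
    then have "i = n \<or> coeff p i = 0" using that by (auto simp: I_def)
    then show ?thesis
      by (auto simp: c_def)
  qed
  define p2 where "p2 = Poly (map c [0..<Suc n])"
  have coeff_p2: "coeff p2 i = (if i \<le> n then c i else 0)" for i
    by (auto simp: p2_def nth_default_def simp del: upt_Suc)
  have "c n = 1"
    using c[of n] monic deg by simp
  then have deg2: "degree p2 = n"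
    by (intro antisym degree_le le_degree) (auto simp: coeff_p2)
  have "coeff p i0 \<noteq> 0" using i0 by (simp add: I_def)
  have "c i0 $ 0 = ramify v (coeff p i0) $ (subdegree (ramify v (coeff p i0)))"
    unfolding subdegree_ramify[OF v] by (simp add: c_def u_def v_def)
  then have "c i0 $ 0 \<noteq> 0"
    using ramify_eq_0_iff[OF v] \<open>coeff p i0 \<noteq> 0\<close> by auto
  then show thesis
    using v deg2 \<open>c n = 1\<close> c i0
    by (intro that[of v p2 u i0]) (auto simp: coeff_p2 I_def)
qed

text \<open>Induction on the degree. Once the trace is removed, either the polynomial is a power of
  \<open>Y\<close>, or rescaling gives a polynomial, again of trace zero, whose reduction has two
  distinct roots; this one factors into monic polynomials of smaller degree.\<close>

theorem puiseux:
  fixes p :: "'a::{alg_closed_field, field_char_0} fps poly"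
  assumes "lead_coeff p = 1"
  shows "\<exists>m bs. splits m p bs"
  using assms
proof (induction "degree p" arbitrary: p rule: less_induct)
  case less
  \<comment> \<open>The two factors may split over different denominators; each is ramified by the
    denominator of the other before the lists of roots are joined.\<close>
  have factor: "\<exists>m bs. splits m (q * r) bs"
    if qr: "lead_coeff q = 1" "lead_coeff r = 1" "degree q < degree p" "degree r < degree p"
    for q r :: "'a fps poly"
  proof -
    obtain m bs m' bs' where "splits m q bs" "splits m' r bs'"
      using less.hyps[OF qr(3,1)] less.hyps[OF qr(4,2)] by blast
    moreover have "m > 0" "m' > 0" using calculation by (auto simp: splits_def)
    ultimately show ?thesis
      using splits_mult splits_ramify by (metis mult.commute)
  qed
  show ?case
  proof (cases "degree p")
    case 0
    then have "p = 1" using less.prems by (metis lead_coeff_pCons(2) degree_eq_zeroE one_pCons)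
    then have "splits 1 p []"
      by (simp add: splits_def)
    then show ?thesis by blast
  next
    case (Suc n)
    define c where "c = - coeff p n * fps_const (1 / of_nat (Suc n))"
    define P where "P = pcompose p [:c, 1:]"
    have P: "lead_coeff P = 1" "degree P = Suc n"
      using monic_pcompose_shift[OF less.prems, of c] Suc by (auto simp: P_def)
    have "of_nat (Suc n) * fps_const (1 / of_nat (Suc n)) = (1 :: 'a fps)"
      by (simp only: fps_const_mult flip: fps_of_nat) (simp del: of_nat_Suc)
    then have "of_nat (Suc n) * c = - coeff p n"
      by (simp add: c_def mult.left_commute[of "of_nat (Suc n)"] del: of_nat_Suc)
    then have trace: "coeff P n = 0"
      using coeff_pcompose_shift_pred_degree[OF less.prems Suc, of c] by (simp add: P_def del: of_nat_Suc)
    have "\<exists>m bs. splits m P bs"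
    proof (cases "P = monom 1 (Suc n)")
      case True
      have "map_poly (ramify 1) P = monom 1 (Suc n)"
        by (simp add: True map_poly_monom)
      then have "splits 1 P (replicate (Suc n) 0)"
        by (simp add: splits_def prod_list_replicate monom_altdef del: replicate_Suc)
      then show ?thesis by blast
    next
      case False
      obtain v u p2 i0 where v: "v > 0" and p2: "lead_coeff p2 = 1" "degree p2 = Suc n"
        and coeffs: "\<And>i. i \<le> Suc n \<Longrightarrow> ramify v (coeff P i) = (fps_X ^ u) ^ (Suc n - i) * coeff p2 i"
        and i0: "i0 < Suc n" "coeff p2 i0 $ 0 \<noteq> 0"
        using minimal_slope_rescaling[OF P False] by metis
      have "coeff p2 n = 0"
        using coeffs[of n] trace ramify_eq_0_iff[OF v, of 0] by simp
      then obtain q r where "p2 = q * r" "lead_coeff q = 1" "lead_coeff r = 1"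
        "degree q < degree p2" "degree r < degree p2"
        using monic_factor_of_reduction_trace_0[OF p2 _ _ i0(2)] i0(1) by (metis less_Suc_eq_le)
      then obtain w bs where bs: "splits w p2 bs"
        using factor p2(2) Suc by metis
      then have w: "w > 0" by (simp add: splits_def)
      interpret ram: comm_ring_map "ramify w :: 'a fps \<Rightarrow> _"
        using w by (rule ramify_comm_ring_map)
      interpret ramv: comm_ring_map "ramify v :: 'a fps \<Rightarrow> _"
        using v by (rule ramify_comm_ring_map)
      interpret ramvw: comm_ring_map "ramify (v * w) :: 'a fps \<Rightarrow> _"
        using v w by (intro ramify_comm_ring_map) simp
      let ?x = "ramify w (fps_X ^ u) :: 'a fps"
      have ram_power: "ramify w (a ^ k) = ramify w a ^ k" for a :: "'a fps" and k
        by (induction k) (simp_all add: ram.map_one ram.map_mult)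
      have "map_poly (ramify (v * w)) P = (\<Prod>\<beta>\<leftarrow>bs. [:- (?x * \<beta>), 1:])"
      proof (rule linear_factors_scale[where n = "Suc n" and Q = "map_poly (ramify w) p2"])
        show "?x \<noteq> 0" by (simp add: ramify_eq_0_iff[OF w])
        show "coeff (map_poly (ramify (v * w)) P) i = ?x ^ (Suc n - i) * coeff (map_poly (ramify w) p2) i"
          if "i \<le> Suc n" for i
          using arg_cong[OF coeffs[OF that], of "ramify w"]
          by (simp add: coeff_map_poly ramify_ramify[OF v w] ram.map_mult ram_power)
        show "degree (map_poly (ramify w) p2) = Suc n" "degree (map_poly (ramify (v * w)) P) = Suc n"
          using ram.degree_map_poly_monic[OF p2(1)] ramvw.degree_map_poly_monic[OF P(1)] P p2 by simp_all
        show "map_poly (ramify w) p2 = (\<Prod>\<beta>\<leftarrow>bs. [:- \<beta>, 1:])"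
          using bs by (simp add: splits_def)
      qed
      then have "splits (v * w) P (map ((*) ?x) bs)"
        using v w by (simp add: splits_def o_def)
      then show ?thesis by blast
    qed
    then show ?thesis
      using splits_shift unfolding P_def by blast
  qed
qed

section \<open>Bounds for intersection multiplicities\<close>

text \<open>Gaussian elimination: each of the \<open>d\<close> homogeneous equations costs at most
  one of the solutions \<open>T j\<close>. The solutions stay normalised to unit vectors on
  \<open>J\<close>, so the coefficients of any combination of them can be read off on
  \<open>J\<close>.\<close>

lemma homogeneous_elimination:
  fixes a :: "'i \<Rightarrow> nat \<Rightarrow> 'a::field"
  assumes "finite I"
  shows "\<exists>J T. J \<subseteq> I \<and> card I \<le> card J + d \<and>
    (\<forall>j\<in>J. \<forall>j'\<in>J. T j j' = (if j = j' then 1 else 0)) \<and>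
    (\<forall>j\<in>J. \<forall>l<d. (\<Sum>i\<in>I. T j i * a i l) = 0)"
proof (induction d)
  case 0
  show ?case
    by (intro exI[of _ I] exI[of _ "\<lambda>j j'. if j = j' then 1 else 0"]) auto
next
  case (Suc d)
  then obtain J T where J: "J \<subseteq> I" "card I \<le> card J + d"
    and T: "\<forall>j\<in>J. \<forall>j'\<in>J. T j j' = (if j = j' then 1 else 0)"
    and sol: "\<forall>j\<in>J. \<forall>l<d. (\<Sum>i\<in>I. T j i * a i l) = 0"
    by blast
  define b where "b j = (\<Sum>i\<in>I. T j i * a i d)" for j
  show ?case
  proof (cases "\<forall>j\<in>J. b j = 0")
    case True
    with J T sol show ?thesis
      by (intro exI[of _ J] exI[of _ T]) (auto simp: less_Suc_eq b_def)
  next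
    case False
    then obtain j0 where j0: "j0 \<in> J" "b j0 \<noteq> 0" by blast
    define T' where "T' j i = T j i - b j / b j0 * T j0 i" for j i
    have "finite J" using J(1) assms by (rule finite_subset)
    then have card: "card J = Suc (card (J - {j0}))"
      using card_Suc_Diff1[OF _ j0(1)] by simp
    have T'_sum: "(\<Sum>i\<in>I. T' j i * a i l) =
        (\<Sum>i\<in>I. T j i * a i l) - b j / b j0 * (\<Sum>i\<in>I. T j0 i * a i l)" for j l
      by (simp add: T'_def left_diff_distrib sum_subtractf sum_distrib_left mult.assoc)
    have "(\<Sum>i\<in>I. T' j i * a i l) = 0" if "j \<in> J" "l < Suc d" for j l
    proof (cases "l = d")
      case True
      then show ?thesis unfolding T'_sum using j0(2) by (simp flip: b_def)
    next
      case False
      then show ?thesis unfolding T'_sum using sol that j0(1) by simp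
    qed
    moreover have "T' j j' = (if j = j' then 1 else 0)" if "j \<in> J - {j0}" "j' \<in> J - {j0}" for j j'
      using T j0(1) that by (auto simp: T'_def)
    ultimately show ?thesis
      using J card by (intro exI[of _ "J - {j0}"] exI[of _ T']) auto
  qed
qed

lemma fps_const_sum: "fps_const (sum f A) = (\<Sum>x\<in>A. fps_const (f x))"
  by (intro fps_ext) (simp add: fps_sum_nth)

lemma smult_sum_right: "smult c (sum f A) = (\<Sum>x\<in>A. smult c (f x))"
  by (intro poly_eqI) (simp add: coeff_sum sum_distrib_left)

text \<open>Each linear factor \<open>Y - \<beta>\<close> contributes \<open>K[[t]]/F(\<beta>)\<close> to the dimension of the quotient
  of \<open>K[[t]][Y]\<close> by \<open>F\<close> and the product.\<close>
lemma linear_relation_mod_linear_factors: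
  fixes F :: "'a::field fps poly" and r :: "'i \<Rightarrow> 'a fps poly"
  assumes "finite I" "\<And>\<beta>. \<beta> \<in> set bs \<Longrightarrow> poly F \<beta> \<noteq> 0"
    and "card I > (\<Sum>\<beta>\<leftarrow>bs. subdegree (poly F \<beta>))"
  shows "\<exists>c A B. (\<exists>i\<in>I. c i \<noteq> 0) \<and>
    (\<Sum>i\<in>I. smult (fps_const (c i)) (r i)) = A * F + B * (\<Prod>\<beta>\<leftarrow>bs. [:- \<beta>, 1:])"
  using assms
proof (induction bs arbitrary: I r)
  case Nil
  then have "I \<noteq> {}" by auto
  then show ?case
    by (intro exI[of _ "\<lambda>_. 1"] exI[of _ 0] exI[of _ "\<Sum>i\<in>I. r i"]) auto
next
  case (Cons \<beta> bs)
  define d where "d = subdegree (poly F \<beta>)"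
  have F: "poly F \<beta> \<noteq> 0" using Cons.prems by simp
  obtain J T where J: "J \<subseteq> I" "card I \<le> card J + d"
    and T: "\<forall>j\<in>J. \<forall>j'\<in>J. T j j' = (if j = j' then 1 else 0)"
    and sol: "\<forall>j\<in>J. \<forall>l<d. (\<Sum>i\<in>I. T j i * poly (r i) \<beta> $ l) = 0"
    using homogeneous_elimination[OF Cons.prems(1), of d "\<lambda>i l. poly (r i) \<beta> $ l"] by blast
  define r' where "r' j = (\<Sum>i\<in>I. smult (fps_const (T j i)) (r i))" for j
  \<comment> \<open>The equations make \<open>poly (r' j) \<beta>\<close> vanish to the order
    \<open>d\<close> of \<open>F(\<beta>)\<close>, hence divisible by it. Subtracting a multiple of
    \<open>F\<close> leaves a polynomial with root \<beta>, whose quotient by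
    \<open>Y - \<beta>\<close> enters the induction.\<close>
  have "\<exists>e s. r' j = [:e:] * F + [:- \<beta>, 1:] * s" if "j \<in> J" for j
  proof -
    have "poly (r' j) \<beta> $ l = 0" if "l < d" for l
      using sol \<open>j \<in> J\<close> that by (simp add: r'_def poly_sum fps_sum_nth)
    then have "poly F \<beta> dvd poly (r' j) \<beta>"
      using F by (cases "poly (r' j) \<beta> = 0")
        (auto simp: fps_dvd_iff d_def intro: subdegree_geI)
    then obtain e where "poly (r' j) \<beta> = poly F \<beta> * e" by (elim dvdE)
    then have "poly (r' j - [:e:] * F) \<beta> = 0" by (simp add: mult.commute)
    then have "[:- \<beta>, 1:] dvd (r' j - [:e:] * F)" by (simp only: poly_eq_0_iff_dvd)
    then obtain s where "r' j - [:e:] * F = [:- \<beta>, 1:] * s" by (elim dvdE)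
    then have "r' j = [:e:] * F + [:- \<beta>, 1:] * s" by (simp only: diff_eq_eq add.commute)
    then show ?thesis by blast
  qed
  then obtain e s where es: "\<And>j. j \<in> J \<Longrightarrow> r' j = [:e j:] * F + [:- \<beta>, 1:] * s j"
    by metis
  have "finite J" using J(1) Cons.prems(1) by (rule finite_subset)
  moreover have "card J > (\<Sum>\<beta>\<leftarrow>bs. subdegree (poly F \<beta>))"
    using Cons.prems(3) J(2) by (simp add: d_def)
  ultimately obtain c A B where c: "\<exists>j\<in>J. c j \<noteq> 0"
    and AB: "(\<Sum>j\<in>J. smult (fps_const (c j)) (s j)) = A * F + B * (\<Prod>\<beta>\<leftarrow>bs. [:- \<beta>, 1:])"
    using Cons.IH[of J s] Cons.prems(2) by auto
  define c' where "c' i = (\<Sum>j\<in>J. c j * T j i)" for i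
  \<comment> \<open>By the normalisation of \<open>T\<close> on \<open>J\<close>, the relation stays
    nontrivial when rewritten in the original family.\<close>
  have "c' j = c j" if "j \<in> J" for j
  proof -
    have "c' j = (\<Sum>j'\<in>J. if j' = j then c j else 0)"
      unfolding c'_def using T that by (intro sum.cong) auto
    then show ?thesis using that \<open>finite J\<close> by simp
  qed
  then have nz: "\<exists>i\<in>I. c' i \<noteq> 0" using c J(1) by (metis subsetD)
  have "(\<Sum>i\<in>I. smult (fps_const (c' i)) (r i)) =
      (\<Sum>i\<in>I. \<Sum>j\<in>J. smult (fps_const (c j)) (smult (fps_const (T j i)) (r i)))"
    by (simp add: c'_def smult_sum fps_const_sum)
  also have "\<dots> = (\<Sum>j\<in>J. smult (fps_const (c j)) (r' j))"
    unfolding r'_def smult_sum_right by (rule sum.swap)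
  also have "\<dots> = (\<Sum>j\<in>J. [:fps_const (c j) * e j:] * F + [:- \<beta>, 1:] * smult (fps_const (c j)) (s j))"
    by (intro sum.cong) (simp_all add: es smult_add_right)
  also have "\<dots> = (\<Sum>j\<in>J. [:fps_const (c j) * e j:]) * F +
      [:- \<beta>, 1:] * (\<Sum>j\<in>J. smult (fps_const (c j)) (s j))"
    by (simp only: sum.distrib sum_distrib_left sum_distrib_right)
  also have "\<dots> = ((\<Sum>j\<in>J. [:fps_const (c j) * e j:]) + [:- \<beta>, 1:] * A) * F +
      B * (\<Prod>\<beta>\<leftarrow>\<beta> # bs. [:- \<beta>, 1:])"
    unfolding AB by (simp only: list.map prod_list.Cons distrib_left distrib_right ac_simps)
  finally show ?case using nz by blast
qed

text \<open>The coordinates of \<open>K[[t]]\<close> as a free \<open>K[[t^m]]\<close>-module with basis \<open>1, t, \<dots>, t^(m-1)\<close>.\<close>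
definition fps_section :: "nat \<Rightarrow> nat \<Rightarrow> 'a::comm_ring_1 fps \<Rightarrow> 'a fps" where
  "fps_section m j h = Abs_fps (\<lambda>k. h $ (m * k + j))"

lemma fps_section_0 [simp]: "fps_section m j 0 = 0"
  by (simp add: fps_section_def fps_eq_iff)

lemma fps_section_add: "fps_section m j (g + h) = fps_section m j g + fps_section m j h"
  by (simp add: fps_section_def fps_eq_iff)

lemma fps_section_sum: "fps_section m j (sum f A) = (\<Sum>x\<in>A. fps_section m j (f x))"
  by (simp add: fps_section_def fps_eq_iff fps_sum_nth)

lemma fps_section_ramify_mult:
  assumes "j < m"
  shows "fps_section m j (ramify m c * h) = c * fps_section m j h"
proof (intro fps_ext)
  fix k
  have m: "m > 0" using assms by simp
  have "fps_section m j (ramify m c * h) $ k =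
      (\<Sum>i\<in>{0..m * k + j}. ramify m c $ i * h $ (m * k + j - i))"
    by (simp add: fps_section_def fps_mult_nth)
  also have "\<dots> = (\<Sum>i\<in>(*) m ` {0..k}. ramify m c $ i * h $ (m * k + j - i))"
  proof (intro sum.mono_neutral_right ballI)
    fix i assume i: "i \<in> {0..m * k + j} - (*) m ` {0..k}"
    have "\<not> m dvd i"
    proof
      assume "m dvd i"
      then obtain l where l: "i = m * l" by (elim dvdE)
      then have "m * l < m * Suc k" using i assms by simp
      then have "l \<le> k" by (metis mult_less_cancel1 less_Suc_eq_le)
      then show False using i l by auto
    qed
    then show "ramify m c $ i * h $ (m * k + j - i) = 0" by (simp add: ramify_nth[OF m])
  qed (auto simp: trans_le_add1)
  also have "\<dots> = (\<Sum>l\<in>{0..k}. c $ l * h $ (m * k + j - m * l))"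
    using m by (subst sum.reindex) (auto simp: inj_on_def ramify_nth)
  also have "\<dots> = (\<Sum>l\<in>{0..k}. c $ l * h $ (m * (k - l) + j))"
    by (intro sum.cong) (auto simp: diff_mult_distrib2 algebra_simps)
  also have "\<dots> = (c * fps_section m j h) $ k"
    by (simp add: fps_section_def fps_mult_nth)
  finally show "fps_section m j (ramify m c * h) $ k = (c * fps_section m j h) $ k" .
qed

lemma fps_section_X_power:
  assumes "j < m" "i < m"
  shows "fps_section m j (fps_X ^ i) = (if i = j then 1 else 0)"
proof -
  have "m * k + j = i \<longleftrightarrow> k = 0 \<and> i = j" for k
    using assms by (cases k) auto
  then show ?thesis by (auto simp: fps_section_def fps_eq_iff)
qed

text \<open>Taking a coordinate is linear over the image of \<open>K[[X]][Y]\<close>. So a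
  combination of \<open>f1\<close> and \<open>g1\<close> with coefficients over
  \<open>K[[t]]\<close> goes to one with coefficients over \<open>K[[X]]\<close>.\<close>

lemma map_poly_fps_section_ramify_mult:
  fixes p q :: "'a::idom fps poly"
  assumes "j < m"
  shows "map_poly (fps_section m j) (map_poly (ramify m) p * q) = p * map_poly (fps_section m j) q"
  by (intro poly_eqI)
     (simp add: coeff_map_poly coeff_mult fps_section_sum fps_section_ramify_mult[OF assms])

text \<open>Replace the \<open>b i\<close> by their remainders \<open>r i\<close> modulo
  \<open>g\<close> and form the \<open>k * m\<close> polynomials \<open>t^j r_i\<close> with
  \<open>j < m\<close>. If they outnumbered the sum, a nontrivial combination would lie in the ideal
  of \<open>f1\<close> and \<open>g1\<close> over \<open>K[[t]]\<close>; the coordinate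
  \<open>j0\<close> of a nonzero coefficient kills all other powers of \<open>t\<close> and leaves a
  forbidden relation between the \<open>b i\<close>.\<close>

lemma indep_mod_bound:
  fixes f g :: "'a::field fps fps"
  assumes g: "y_regular g n" and "fps_of_poly f1 = u * f" "fps_of_poly g1 = v * g"
    and split: "splits m g1 bs"
    and nz: "\<And>\<beta>. \<beta> \<in> set bs \<Longrightarrow> poly (map_poly (ramify m) f1) \<beta> \<noteq> 0"
    and indep: "indep_mod f g k b"
  shows "k * m \<le> (\<Sum>\<beta>\<leftarrow>bs. subdegree (poly (map_poly (ramify m) f1) \<beta>))"
proof (rule ccontr)
  assume contra: "\<not> ?thesis"
  have m: "m > 0" using split by (simp add: splits_def)
  have "\<exists>q r. b i = q * g + fps_of_poly r" for i
    using weierstrass_division[OF g, of "b i"] by metis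
  then obtain q r where qr: "\<And>i. b i = q i * g + fps_of_poly (r i)" by metis
  define I where "I = {..<k} \<times> {..<m}"
  define R where "R = (\<lambda>(i, j). map_poly (ramify m) (r i) * [:fps_X ^ j:])"
  let ?F = "map_poly (ramify m) f1"
  have "card I > (\<Sum>\<beta>\<leftarrow>bs. subdegree (poly ?F \<beta>))"
    using contra by (simp add: I_def)
  then obtain c A B where c: "\<exists>x\<in>I. c x \<noteq> 0"
    and AB: "(\<Sum>x\<in>I. smult (fps_const (c x)) (R x)) = A * ?F + B * (\<Prod>\<beta>\<leftarrow>bs. [:- \<beta>, 1:])"
    using linear_relation_mod_linear_factors[of I bs ?F R, OF _ nz] by (auto simp only: I_def finite_cartesian_product finite_lessThan)
  obtain i0 j0 where ij: "i0 < k" "j0 < m" "c (i0, j0) \<noteq> 0"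
    using c by (auto simp: I_def)
  let ?S = "map_poly (fps_section m j0)"
  have S_sum: "?S (sum h X) = (\<Sum>x\<in>X. ?S (h x))" for h :: "nat \<times> nat \<Rightarrow> 'a fps poly" and X
    by (intro poly_eqI) (simp add: coeff_map_poly fps_section_sum coeff_sum)
  have S_add: "?S (p + q) = ?S p + ?S q" for p q :: "'a fps poly"
    by (intro poly_eqI) (simp add: coeff_map_poly fps_section_add)
  have S_R: "?S (smult (fps_const (c (i, j))) (R (i, j))) =
      (if j = j0 then smult (fps_const (c (i, j))) (r i) else 0)" if "j < m" for i j
  proof -
    have "ramify m (fps_const (c (i, j))) = fps_const (c (i, j))"
      by (simp add: ramify_def)
    then have "smult (fps_const (c (i, j))) (R (i, j)) =
        map_poly (ramify m) (smult (fps_const (c (i, j))) (r i)) * [:fps_X ^ j:]"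
      by (simp add: R_def map_poly_smult comm_ring_map.map_mult[OF ramify_comm_ring_map[OF m]]
          mult.commute[of "fps_X ^ j"])
    then show ?thesis
      using map_poly_fps_section_ramify_mult[OF ij(2), of "smult (fps_const (c (i, j))) (r i)" "[:fps_X ^ j:]"]
      by (simp add: map_poly_pCons fps_section_X_power[OF ij(2) that])
  qed
  have "(\<Sum>i<k. smult (fps_const (c (i, j0))) (r i)) =
      (\<Sum>i<k. \<Sum>j<m. if j = j0 then smult (fps_const (c (i, j))) (r i) else 0)"
    using ij(2) by simp
  also have "\<dots> = (\<Sum>x\<in>I. ?S (smult (fps_const (c x)) (R x)))"
    unfolding I_def sum.cartesian_product by (intro sum.cong) (auto simp: S_R)
  also have "\<dots> = ?S (?F * A + map_poly (ramify m) g1 * B)"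
    using split by (simp only: flip: S_sum) (simp add: AB splits_def mult.commute)
  also have "\<dots> = f1 * ?S A + g1 * ?S B"
    by (simp add: S_add map_poly_fps_section_ramify_mult[OF ij(2)])
  finally have "fps_of_poly (\<Sum>i<k. smult (fps_const (c (i, j0))) (r i)) =
      (fps_of_poly (?S A) * u) * f + (fps_of_poly (?S B) * v) * g"
    using assms(2,3) by (simp add: fps_of_poly_add fps_of_poly_mult ac_simps)
  moreover have "(\<Sum>i<k. bconst (c (i, j0)) * b i) =
      (\<Sum>i<k. bconst (c (i, j0)) * q i) * g + fps_of_poly (\<Sum>i<k. smult (fps_const (c (i, j0))) (r i))"
    by (simp add: qr distrib_left sum.distrib sum_distrib_right fps_of_poly_sum fps_of_poly_smult
        bconst_def mult.assoc)
  ultimately have "(\<Sum>i<k. bconst (c (i, j0)) * b i) =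
      (fps_of_poly (?S A) * u) * f + ((\<Sum>i<k. bconst (c (i, j0)) * q i) + fps_of_poly (?S B) * v) * g"
    by (simp add: algebra_simps)
  then have "in_ideal2 f g (\<Sum>i<k. bconst (c (i, j0)) * b i)"
    unfolding in_ideal2_def by blast
  then have "\<forall>i<k. c (i, j0) = 0"
    using indep[unfolded indep_mod_def, rule_format, of "\<lambda>i. c (i, j0)"] by blast
  then show False using ij by simp
qed

section \<open>Intersection multiplicity with \<open>X\<close> as the order of
  \<open>f(0,Y)\<close>\<close>

lemma le_i0_varX:
  fixes f :: "'a::field fps fps"
  assumes "\<forall>j<k. f $ j $ 0 = 0"
  shows "enat k \<le> i0 f varX"
proof -
  have "indep_mod f varX k (\<lambda>i. fps_X ^ i)"
    unfolding indep_mod_def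
  proof (intro allI impI)
    fix c :: "nat \<Rightarrow> 'a" and j
    assume "in_ideal2 f varX (\<Sum>i<k. bconst (c i) * fps_X ^ i)" and j: "j < k"
    then obtain a b where ab: "(\<Sum>i<k. bconst (c i) * fps_X ^ i) = a * f + b * varX"
      by (auto simp: in_ideal2_def)
    have "(bconst (c i) * fps_X ^ i) $ j $ 0 = (if j = i then c i else 0)" for i
      by (simp add: bconst_def)
    then have "(\<Sum>i<k. bconst (c i) * fps_X ^ i) $ j $ 0 = (\<Sum>i<k. if j = i then c i else 0)"
      by (simp only: fps_sum_nth)
    also have "\<dots> = c j" using j by simp
    finally have "c j = (a * f) $ j $ 0 + (b * varX) $ j $ 0"
      unfolding ab by simp
    also have "(a * f) $ j $ 0 = 0"
      using assms j by (simp add: fps_mult_nth fps_sum_nth)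
    also have "(b * varX) $ j $ 0 = 0"
      by (simp add: mult.commute[of b] varX_def)
    finally show "c j = 0" by simp
  qed
  then show ?thesis
    unfolding i0_def by (intro SUP_upper) blast
qed

text \<open>Among more than \<open>n\<close> series some nontrivial combination \<open>h\<close> has
  no terms of \<open>Y\<close>-degree below \<open>n\<close> at \<open>X = 0\<close>. Its remainder
  modulo \<open>f\<close> then vanishes at \<open>X = 0\<close>, so is divisible by
  \<open>X\<close>, and \<open>h\<close> lies in the ideal of \<open>f\<close> and
  \<open>X\<close>.\<close>

lemma y_regular_imp_i0_varX_le:
  fixes f :: "'a::field fps fps"
  assumes f: "y_regular f n"
  shows "i0 f varX \<le> enat n"
  unfolding i0_def
proof (rule SUP_least, clarify)
  fix k b
  assume indep: "indep_mod f varX k b"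
  show "enat k \<le> enat n"
  proof (rule ccontr)
    assume "\<not> enat k \<le> enat n"
    then have "card {..<k} > n" by simp
    moreover obtain J T where J: "J \<subseteq> {..<k}" "card {..<k} \<le> card J + n"
      and T: "\<forall>j\<in>J. \<forall>j'\<in>J. T j j' = (if j = j' then 1 else 0)"
      and sol: "\<forall>j\<in>J. \<forall>l<n. (\<Sum>i<k. T j i * b i $ l $ 0) = 0"
      using homogeneous_elimination[of "{..<k}" n "\<lambda>i l. b i $ l $ 0"] by blast
    ultimately have "J \<noteq> {}" by auto
    then obtain j where j: "j \<in> J" by blast
    define h where "h = (\<Sum>i<k. bconst (T j i) * b i)"
    obtain q r where qr: "h = q * f + fps_of_poly r" "\<forall>l\<ge>n. coeff r l = 0"
      using weierstrass_division[OF f] by blast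
    have "coeff r l $ 0 = 0" if "l < n" for l
    proof -
      have "h $ l $ 0 = 0"
        using sol j that by (simp add: h_def fps_sum_nth bconst_def)
      moreover have "(q * f) $ l $ 0 = 0"
        using f that by (simp add: fps_mult_nth fps_sum_nth y_regular_def)
      ultimately show ?thesis
        using arg_cong[OF qr(1), of "\<lambda>h. h $ l $ 0"] by simp
    qed
    then have r0: "coeff r l $ 0 = 0" for l
      using qr(2) by (cases "l < n") auto
    have "fps_of_poly r = varX * Abs_fps (\<lambda>l. fps_shift 1 (coeff r l))"
      by (intro fps_ext, subst varX_mult_nth_nth) (simp add: r0)
    then have "in_ideal2 f varX h"
      using qr(1) unfolding in_ideal2_def by (metis mult.commute)
    then have "\<forall>i<k. T j i = 0"
      using indep unfolding indep_mod_def h_def by blast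
    then show False using T j J(1) by (metis lessThan_iff subsetD zero_neq_one)
  qed
qed

lemma i0_varX_eq_imp_y_regular:
  fixes f :: "'a::field fps fps"
  assumes "i0 f varX = enat n"
  shows "y_regular f n"
proof -
  have "\<exists>j. f $ j $ 0 \<noteq> 0"
    using le_i0_varX[of "Suc n" f] assms by fastforce
  define k where "k = (LEAST j. f $ j $ 0 \<noteq> 0)"
  have "f $ k $ 0 \<noteq> 0"
    unfolding k_def using \<open>\<exists>j. f $ j $ 0 \<noteq> 0\<close> by (rule LeastI_ex)
  moreover have below: "\<forall>j<k. f $ j $ 0 = 0"
    unfolding k_def using not_less_Least by blast
  ultimately have reg: "y_regular f k" by (simp add: y_regular_def)
  have "k = n"
    using y_regular_imp_i0_varX_le[OF reg] le_i0_varX[OF below] assms by simp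
  with reg show ?thesis by simp
qed

section \<open>Roots of unity acting on Puiseux series\<close>

lemma card_roots_unity_alg_closed:
  assumes "d > 0"
  shows "card {z :: 'a::{alg_closed_field, field_char_0}. z ^ d = 1} = d"
proof -
  define p :: "'a poly" where "p = monom 1 d - 1"
  have root: "poly p z = 0 \<longleftrightarrow> z ^ d = 1" for z
    by (simp add: p_def poly_monom)
  have "coeff p d = 1" using assms by (simp add: p_def)
  then have "p \<noteq> 0" by auto
  have deg: "degree p = d"
    using assms \<open>coeff p d = 1\<close> by (intro antisym degree_le le_degree) (auto simp: p_def)
  have "rsquarefree p"
    unfolding rsquarefree_roots
  proof (intro allI notI, elim conjE)
    fix a assume a: "poly p a = 0" "poly (pderiv p) a = 0"
    then have "a \<noteq> 0" using assms by (auto simp: root zero_power)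
    moreover have "pderiv p = monom (of_nat d) (d - 1)"
      by (simp add: p_def pderiv_diff pderiv_monom)
    ultimately show False using a(2) assms by (simp add: poly_monom)
  qed
  then have ord: "order a p \<le> 1" for a
    unfolding rsquarefree_def by (metis le_numeral_extra(4) zero_le)
  obtain A where A: "size A = d" "p = smult (lead_coeff p) (\<Prod>x\<in>#A. [:- x, 1:])"
    using alg_closed_imp_factorization[OF \<open>p \<noteq> 0\<close>] deg by auto
  then have pA: "p = (\<Prod>x\<in>#A. [:- x, 1:])" using deg \<open>coeff p d = 1\<close> by simp
  have "count A x \<le> 1" for x
  proof (rule ccontr)
    assume "\<not> count A x \<le> 1"
    then have "{#x, x#} \<subseteq># A" by (auto simp: subseteq_mset_def)
    then obtain B where "A = {#x, x#} + B" by (auto simp: subset_mset.le_iff_add)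
    then have "[:- x, 1:] ^ 2 dvd p"
      unfolding pA by (simp add: power2_eq_square mult.assoc[symmetric] del: mult_pCons_left)
    then have "2 \<le> order x p" using \<open>p \<noteq> 0\<close> by (simp add: order_divides)
    then show False using ord[of x] by simp
  qed
  then have "A = mset_set (set_mset A)"
    by (intro multiset_eqI) (metis count_mset_set(1) count_mset_set(3) count_eq_zero_iff finite_set_mset
        le_neq_implies_less less_one)
  then have "card (set_mset A) = d" using A(1) by (metis size_mset_set)
  moreover have "set_mset A = {z. z ^ d = 1}"
  proof -
    have "z \<in># A \<longleftrightarrow> poly p z = 0" for z
      unfolding pA by (induction A) auto
    then show ?thesis by (auto simp: root)
  qed
  ultimately show ?thesis by simp
qed

lemma finite_roots_unity_alg_closed:
  "d > 0 \<Longrightarrow> finite {z :: 'a::{alg_closed_field, field_char_0}. z ^ d = 1}"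
  using card_roots_unity_alg_closed[of d] by (metis card.infinite less_numeral_extra(3))

lemma power_gcd_eq_1_iff:
  fixes z :: "'a::field"
  assumes "a > 0"
  shows "z ^ gcd a b = 1 \<longleftrightarrow> z ^ a = 1 \<and> z ^ b = 1"
proof
  assume "z ^ gcd a b = 1"
  then show "z ^ a = 1 \<and> z ^ b = 1"
    by (metis dvd_def gcd_dvd1 gcd_dvd2 power_mult power_one)
next
  assume z: "z ^ a = 1 \<and> z ^ b = 1"
  obtain x y where "a * x = b * y + gcd a b" using bezout_nat[of a b] assms by auto
  then have "(z ^ a) ^ x = (z ^ b) ^ y * z ^ gcd a b" by (simp flip: power_mult power_add)
  then show "z ^ gcd a b = 1" using z by simp
qed

text \<open>The \<open>m\<close>-th roots of unity that are also \<open>k\<close>-th roots are the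
  \<open>gcd m k\<close>-th roots; counting them gives \<open>m = gcd m k\<close>.\<close>

lemma roots_unity_subset_imp_dvd:
  assumes "m > 0" "{z :: 'a::{alg_closed_field, field_char_0}. z ^ m = 1} \<subseteq> {z. z ^ k = 1}"
  shows "m dvd k"
proof -
  have "{z :: 'a. z ^ gcd m k = 1} = {z. z ^ m = 1}"
    using assms by (auto simp: power_gcd_eq_1_iff)
  then have "m = card {z :: 'a. z ^ gcd m k = 1}"
    by (simp only: card_roots_unity_alg_closed[OF assms(1)])
  also have "\<dots> = gcd m k"
    using assms(1) by (intro card_roots_unity_alg_closed) simp
  finally show ?thesis by (metis gcd_dvd2)
qed

section \<open>The Galois action: \<open>twist z\<close> substitutes \<open>z t\<close> for
  \<open>t\<close>\<close>

definition twist :: "'a::comm_ring_1 \<Rightarrow> 'a fps \<Rightarrow> 'a fps" where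
  "twist z a = fps_compose a (fps_const z * fps_X)"

lemma twist_nth [simp]: "twist z a $ n = z ^ n * a $ n"
  by (simp add: twist_def)

interpretation twist: comm_ring_map "twist z :: 'a::idom fps \<Rightarrow> _"
  by unfold_locales (simp_all add: twist_def fps_compose_add_distrib fps_compose_mult_distrib)

lemma twist_diff: "twist z (a - b) = twist z a - twist z (b :: 'a::comm_ring_1 fps)"
  by (intro fps_ext) (simp add: algebra_simps)

lemma twist_twist: "twist z (twist w a) = twist (z * w) a"
  by (intro fps_ext) (simp add: power_mult_distrib mult.assoc)

lemma twist_1 [simp]: "twist 1 a = a"
  by (intro fps_ext) simp

lemma subdegree_twist:
  fixes a :: "'a::field fps"
  assumes "z \<noteq> 0"
  shows "subdegree (twist z a) = subdegree a"
proof (cases "a = 0")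
  case False
  show ?thesis
  proof (rule subdegreeI)
    show "twist z a $ subdegree a \<noteq> 0"
      using False assms by simp
    show "twist z a $ i = 0" if "i < subdegree a" for i
      using nth_less_subdegree_zero[OF that] by simp
  qed
qed (simp add: twist.map_zero)

lemma twist_ramify: "m > 0 \<Longrightarrow> z ^ m = 1 \<Longrightarrow> twist z (ramify m c) = ramify m c"
  by (intro fps_ext) (auto simp: ramify_nth power_mult)

lemma twist_eq_iff: "z \<noteq> 0 \<Longrightarrow> twist z a = twist z b \<longleftrightarrow> a = (b :: 'a::field fps)"
  by (simp add: fps_eq_iff)

definition orbit :: "nat \<Rightarrow> 'a::field fps \<Rightarrow> 'a fps set" where
  "orbit m \<alpha> = (\<lambda>z. twist z \<alpha>) ` {z. z ^ m = 1}"

definition stab :: "nat \<Rightarrow> 'a::field fps \<Rightarrow> 'a set" where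
  "stab m \<alpha> = {z. z ^ m = 1 \<and> twist z \<alpha> = \<alpha>}"

text \<open>Contacts are measured from \<alpha> alone: since \<open>twist w\<close> preserves
  orders, the contact of any two distinct conjugates is again of this form, by
  \<open>subdegree_orbit_diff\<close>.\<close>

definition orders :: "nat \<Rightarrow> 'a::field fps \<Rightarrow> nat set" where
  "orders m \<alpha> = {subdegree (twist z \<alpha> - \<alpha>) | z. z ^ m = 1 \<and> twist z \<alpha> \<noteq> \<alpha>}"

lemma root_unity_nonzero: "m > 0 \<Longrightarrow> z ^ m = 1 \<Longrightarrow> z \<noteq> (0 :: 'a::field)"
  by (auto simp: zero_power)

context
  fixes m :: nat and \<alpha> :: "'a::{alg_closed_field, field_char_0} fps"
  assumes m: "m > 0"
begin

lemma finite_orbit: "finite (orbit m \<alpha>)"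
  unfolding orbit_def by (intro finite_imageI finite_roots_unity_alg_closed m)

lemma self_in_orbit: "\<alpha> \<in> orbit m \<alpha>"
  unfolding orbit_def by (rule image_eqI[of _ _ 1]) simp_all

lemma finite_orders: "finite (orders m \<alpha>)"
proof (rule finite_subset)
  show "orders m \<alpha> \<subseteq> (\<lambda>z. subdegree (twist z \<alpha> - \<alpha>)) ` {z. z ^ m = 1}"
    by (auto simp: orders_def)
qed (intro finite_imageI finite_roots_unity_alg_closed m)

text \<open>Weighted orbit-stabiliser counting: the roots of unity that take \<alpha> to a given
  conjugate form a coset of the stabiliser. Constant weight gives the orbit size; the contact with
  \<alpha> as weight gives the sum behind \<open>qs\<close>.\<close>

lemma sum_over_orbit:
  fixes \<phi> :: "'a fps \<Rightarrow> nat"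
  shows "(\<Sum>z | z ^ m = 1. \<phi> (twist z \<alpha>)) = card (stab m \<alpha>) * (\<Sum>\<beta>\<in>orbit m \<alpha>. \<phi> \<beta>)"
proof -
  let ?M = "{z :: 'a. z ^ m = 1}"
  have fiber: "card {z \<in> ?M. twist z \<alpha> = twist w \<alpha>} = card (stab m \<alpha>)" if w: "w \<in> ?M" for w
  proof -
    have "w \<noteq> 0" using w root_unity_nonzero[OF m] by simp
    have "bij_betw (\<lambda>z. w * z) (stab m \<alpha>) {z \<in> ?M. twist z \<alpha> = twist w \<alpha>}"
    proof (rule bij_betwI[where g = "\<lambda>z. z / w"])
      show "(\<lambda>z. w * z) \<in> stab m \<alpha> \<rightarrow> {z \<in> ?M. twist z \<alpha> = twist w \<alpha>}"
        using w by (auto simp: stab_def power_mult_distrib simp flip: twist_twist)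
      show "(\<lambda>z. z / w) \<in> {z \<in> ?M. twist z \<alpha> = twist w \<alpha>} \<rightarrow> stab m \<alpha>"
      proof
        fix z assume z: "z \<in> {z \<in> ?M. twist z \<alpha> = twist w \<alpha>}"
        have "twist w (twist (z / w) \<alpha>) = twist w \<alpha>"
          using z \<open>w \<noteq> 0\<close> by (simp add: twist_twist)
        then show "z / w \<in> stab m \<alpha>"
          using w z \<open>w \<noteq> 0\<close> by (simp add: stab_def power_divide twist_eq_iff)
      qed
    qed (use \<open>w \<noteq> 0\<close> in simp_all)
    then show ?thesis by (rule bij_betw_same_card[symmetric])
  qed
  have "(\<Sum>z\<in>?M. \<phi> (twist z \<alpha>)) =
      (\<Sum>\<beta>\<in>orbit m \<alpha>. \<Sum>z\<in>{z \<in> ?M. twist z \<alpha> = \<beta>}. \<phi> (twist z \<alpha>))"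
    unfolding orbit_def by (rule sum.image_gen) (rule finite_roots_unity_alg_closed[OF m])
  also have "\<dots> = (\<Sum>\<beta>\<in>orbit m \<alpha>. card (stab m \<alpha>) * \<phi> \<beta>)"
    using fiber by (intro sum.cong) (auto simp: orbit_def)
  finally show ?thesis by (simp add: sum_distrib_left)
qed

lemma card_orbit: "card (stab m \<alpha>) * card (orbit m \<alpha>) = m"
  using sum_over_orbit[of "\<lambda>_. 1"] card_roots_unity_alg_closed[OF m, where 'a = 'a] by simp

lemma twist_image_orbit:
  assumes "z ^ m = 1"
  shows "twist z ` orbit m \<alpha> = orbit m \<alpha>"
proof (rule card_subset_eq[OF finite_orbit])
  show "twist z ` orbit m \<alpha> \<subseteq> orbit m \<alpha>"
  proof safe
    fix \<beta> assume "\<beta> \<in> orbit m \<alpha>"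
    then obtain w where "w ^ m = 1" "\<beta> = twist w \<alpha>" by (auto simp: orbit_def)
    then show "twist z \<beta> \<in> orbit m \<alpha>"
      unfolding orbit_def using assms by (intro image_eqI[of _ _ "z * w"]) (auto simp: twist_twist power_mult_distrib)
  qed
  show "card (twist z ` orbit m \<alpha>) = card (orbit m \<alpha>)"
    using twist_eq_iff[OF root_unity_nonzero[OF m assms]] by (intro card_image) (auto simp: inj_on_def)
qed

text \<open>The twists permute the orbit, so they fix the coefficients of the product. A coefficient
  of \<open>t^k\<close> that survives all \<open>m\<close>-th roots of unity needs
  \<open>m dvd k\<close>; the coefficients are thus series in \<open>t^m\<close>, and the coordinate
  \<open>0\<close> recovers them over \<open>K[[X]]\<close>.\<close>

lemma orbit_poly_descends:
  obtains p where "map_poly (ramify m) p = (\<Prod>\<beta>\<in>orbit m \<alpha>. [:- \<beta>, 1:])"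
proof
  define P where "P = (\<Prod>\<beta>\<in>orbit m \<alpha>. [:- \<beta>, 1:])"
  have "map_poly (twist z) P = P" if "z ^ m = 1" for z
  proof -
    have "map_poly (twist z) P = (\<Prod>\<beta>\<in>orbit m \<alpha>. [:- twist z \<beta>, 1:])"
      by (simp only: P_def twist.map_poly_prod twist.map_poly_linear twist.map_minus)
    also have "\<dots> = (\<Prod>\<beta>\<in>twist z ` orbit m \<alpha>. [:- \<beta>, 1:])"
      using twist_eq_iff[OF root_unity_nonzero[OF m that]]
      by (subst prod.reindex) (auto simp: inj_on_def)
    finally show ?thesis using twist_image_orbit[OF that] by (simp add: P_def)
  qed
  then have invariant: "twist z (coeff P i) = coeff P i" if "z ^ m = 1" for z i
    using that by (metis coeff_map_poly twist.map_zero)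
  have "ramify m (fps_section m 0 (coeff P i)) = coeff P i" for i
  proof (rule fps_ext)
    fix k
    have "m dvd k" if "coeff P i $ k \<noteq> 0"
    proof (rule roots_unity_subset_imp_dvd[OF m])
      show "{z :: 'a. z ^ m = 1} \<subseteq> {z. z ^ k = 1}"
      proof safe
        fix z :: 'a assume "z ^ m = 1"
        then have "z ^ k * coeff P i $ k = coeff P i $ k"
          using invariant by (metis twist_nth)
        then show "z ^ k = 1" using that by simp
      qed
    qed
    then show "ramify m (fps_section m 0 (coeff P i)) $ k = coeff P i $ k"
      by (auto simp: ramify_nth[OF m] fps_section_def)
  qed
  then show "map_poly (ramify m) (map_poly (fps_section m 0) P) = (\<Prod>\<beta>\<in>orbit m \<alpha>. [:- \<beta>, 1:])"
    unfolding P_def[symmetric] by (intro poly_eqI) (simp add: coeff_map_poly)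
qed

lemma orbit_subset_roots:
  assumes "poly (map_poly (ramify m) p) \<alpha> = 0" "\<beta> \<in> orbit m \<alpha>"
  shows "poly (map_poly (ramify m) p) \<beta> = 0"
proof -
  obtain z where z: "z ^ m = 1" "\<beta> = twist z \<alpha>" using assms(2) by (auto simp: orbit_def)
  have "map_poly (twist z) (map_poly (ramify m) p) = map_poly (ramify m) p"
    using twist_ramify[OF m z(1)] by (intro poly_eqI) (simp add: coeff_map_poly twist.map_zero)
  then show ?thesis
    using twist.poly_map_poly[of z "map_poly (ramify m) p" \<alpha>] assms(1) z(2)
    by (simp add: twist.map_zero)
qed

end

lemma prod_linear_monic:
  fixes S :: "'a::idom set"
  assumes "finite S"
  shows "degree (\<Prod>\<beta>\<in>S. [:- \<beta>, 1:]) = card S" "lead_coeff (\<Prod>\<beta>\<in>S. [:- \<beta>, 1:]) = 1"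
proof -
  show "degree (\<Prod>\<beta>\<in>S. [:- \<beta>, 1:]) = card S"
    by (subst degree_prod_eq_sum_degree) auto
  show "lead_coeff (\<Prod>\<beta>\<in>S. [:- \<beta>, 1:]) = 1"
    by (simp only: lead_coeff_prod) simp
qed

lemma prod_linear_dvd:
  fixes p :: "'a::idom poly"
  assumes "finite S" "\<And>\<beta>. \<beta> \<in> S \<Longrightarrow> poly p \<beta> = 0"
  shows "(\<Prod>\<beta>\<in>S. [:- \<beta>, 1:]) dvd p"
  using assms
proof (induction S)
  case (insert \<beta> S)
  then obtain q where q: "p = (\<Prod>\<beta>\<in>S. [:- \<beta>, 1:]) * q" by (auto elim: dvdE)
  have "poly (\<Prod>\<beta>\<in>S. [:- \<beta>, 1:]) \<beta> \<noteq> 0"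
    using insert.hyps by (auto simp: poly_prod)
  moreover have "poly p \<beta> = 0" using insert.prems by simp
  ultimately have "poly q \<beta> = 0" by (simp add: q)
  then have "[:- \<beta>, 1:] dvd q" by (simp only: poly_eq_0_iff_dvd)
  then have "(\<Prod>\<beta>\<in>S. [:- \<beta>, 1:]) * [:- \<beta>, 1:] dvd p"
    unfolding q by (intro mult_dvd_mono dvd_refl)
  then show ?case unfolding prod.insert[OF insert.hyps] by (simp only: mult.commute)
qed simp

lemma monic_eq_prod_linear:
  fixes p :: "'a::idom poly"
  assumes "lead_coeff p = 1" "finite S" "\<And>\<beta>. \<beta> \<in> S \<Longrightarrow> poly p \<beta> = 0" "degree p \<le> card S"
  shows "p = (\<Prod>\<beta>\<in>S. [:- \<beta>, 1:])"
proof -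
  obtain q where q: "p = q * (\<Prod>\<beta>\<in>S. [:- \<beta>, 1:])"
    using prod_linear_dvd[OF assms(2,3)] by (metis dvdE mult.commute)
  have "lead_coeff q = 1" "degree p = degree q + card S"
    using monic_factorD[of q "\<Prod>\<beta>\<in>S. [:- \<beta>, 1:]"] prod_linear_monic[OF assms(2)] assms(1)
    by (simp_all flip: q)
  then have "q = 1" using assms(4)
    by (metis add_le_same_cancel2 degree_eq_zeroE lead_coeff_pCons(2) le_zero_eq one_pCons)
  then show ?thesis using q by simp
qed

lemma weierstrass_poly_iff_reduction:
  fixes p :: "'a::idom fps poly"
  shows "weierstrass_poly p \<longleftrightarrow>
    lead_coeff p = 1 \<and> map_poly (\<lambda>c. c $ 0) p = monom 1 (degree p)"
proof (cases "lead_coeff p = 1")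
  case True
  then show ?thesis
    using poly_eq_monom_iff[OF fps_nth_0.lead_coeff_map_poly_monic[OF True]
        fps_nth_0.degree_map_poly_monic[OF True]]
    by (simp add: weierstrass_poly_def coeff_map_poly)
qed (simp add: weierstrass_poly_def)

lemma weierstrass_poly_mult:
  fixes p q :: "'a::idom fps poly"
  assumes "weierstrass_poly p" "weierstrass_poly q"
  shows "weierstrass_poly (p * q)"
proof -
  have "lead_coeff p = 1" "lead_coeff q = 1"
    using assms by (simp_all add: weierstrass_poly_def)
  moreover from this have "lead_coeff (p * q) = 1"
    by (simp only: lead_coeff_mult) simp
  moreover from calculation have "degree (p * q) = degree p + degree q"
    by (intro monic_factorD(2))
  ultimately show ?thesis
    using assms by (simp add: weierstrass_poly_iff_reduction fps_nth_0.map_poly_mult mult_monom)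
qed

text \<open>The reduction of a factor divides a power of \<open>Y\<close>, so its only root is
  \<open>0\<close>. A monic factor of positive degree thus vanishes at the origin and is no unit,
  which links factorisation in \<open>K[[X]][Y]\<close> to that in \<open>K[[X,Y]]\<close>.\<close>

lemma monic_dvd_weierstrass_poly:
  fixes p :: "'a::alg_closed_field fps poly"
  assumes "weierstrass_poly (p * q)" "lead_coeff p = 1" "degree p > 0"
  shows "coeff p 0 $ 0 = 0"
proof -
  let ?R = "map_poly (\<lambda>c. c $ 0) :: 'a fps poly \<Rightarrow> _"
  have "degree (?R p) > 0"
    using fps_nth_0.degree_map_poly_monic[OF assms(2)] assms(3) by simp
  then obtain c where c: "poly (?R p) c = 0"
    using alg_closed_imp_poly_has_root by blast
  have "?R (p * q) = monom 1 (degree (p * q))"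
    using assms(1) by (simp add: weierstrass_poly_iff_reduction)
  then have "c ^ degree (p * q) = poly (?R p) c * poly (?R q) c"
    by (metis fps_nth_0.map_poly_mult mult_1 poly_monom poly_mult)
  then have "c = 0" using c by simp
  then show ?thesis using c by (simp add: poly_0_coeff_0 coeff_map_poly)
qed

text \<open>The orbit polynomial of one root descends to a monic \<open>p\<close> over
  \<open>K[[X]]\<close> dividing \<open>w\<close>. Irreducibility of \<open>f\<close> in
  \<open>K[[X,Y]]\<close> makes the cofactor a unit, and a unit that is a monic factor of a
  Weierstrass polynomial is \<open>1\<close>.\<close>

lemma irreducible_roots_orbit:
  fixes f :: "'a::{alg_closed_field, field_char_0} fps fps"
  assumes "irreducible f" and w: "weierstrass_poly w" and f: "f = u * fps_of_poly w"
    and m: "m > 0" and root: "poly (map_poly (ramify m) w) \<alpha> = 0"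
  shows "map_poly (ramify m) w = (\<Prod>\<beta>\<in>orbit m \<alpha>. [:- \<beta>, 1:])"
proof -
  interpret ram: comm_ring_map "ramify m :: 'a fps \<Rightarrow> _"
    using m by (rule ramify_comm_ring_map)
  let ?P = "\<Prod>\<beta>\<in>orbit m \<alpha>. [:- \<beta>, 1:]"
  obtain p where p: "map_poly (ramify m) p = ?P"
    using orbit_poly_descends[OF m] .
  have P: "degree ?P = card (orbit m \<alpha>)" "lead_coeff ?P = 1"
    using prod_linear_monic[OF finite_orbit[OF m]] by blast+
  have deg: "degree (map_poly (ramify m) p) = degree p"
    using ramify_eq_0_iff[OF m] by (intro degree_map_poly) auto
  have "ramify m (lead_coeff p) = 1"
    using P(2) deg unfolding p[symmetric] by (simp add: coeff_map_poly)
  then have "ramify m (lead_coeff p - 1) = 0"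
    using ram.map_add[of "lead_coeff p" "- 1"] ram.map_minus[of 1] by simp
  then have lcp: "lead_coeff p = 1"
    using ramify_eq_0_iff[OF m] by (metis eq_iff_diff_eq_0)
  have degp: "degree p > 0"
    using P(1) deg p self_in_orbit[OF m, of \<alpha>] finite_orbit[OF m, of \<alpha>] card_gt_0_iff by fastforce
  \<comment> \<open>Divisibility is known only over \<open>K[[t]]\<close>. The division is made over
    \<open>K[[X]]\<close>; the ramified remainder is divisible by \<open>?P\<close> and of smaller
    degree, hence zero.\<close>
  obtain q r where qr: "w = q * p + r" "\<forall>j\<ge>degree p. coeff r j = 0"
    using monic_division[OF lcp] by blast
  have "?P dvd map_poly (ramify m) w"
    using orbit_subset_roots[OF m root] by (intro prod_linear_dvd finite_orbit m)
  then have "?P dvd map_poly (ramify m) q * ?P + map_poly (ramify m) r"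
    by (simp add: qr(1) ram.map_poly_add ram.map_poly_mult p)
  then have "?P dvd map_poly (ramify m) r"
    by (metis dvd_add_right_iff dvd_triv_right)
  moreover have "map_poly (ramify m) r = 0 \<or> degree (map_poly (ramify m) r) < degree ?P"
  proof -
    have "coeff (map_poly (ramify m) r) j = 0" if "j \<ge> degree ?P" for j
      using qr(2) that deg p by (simp add: coeff_map_poly)
    then show ?thesis by (metis leading_coeff_0_iff linorder_not_le)
  qed
  ultimately have "map_poly (ramify m) r = 0"
    by (metis dvd_imp_degree_le linorder_not_le)
  then have "r = 0"
    using ramify_eq_0_iff[OF m] by (subst (asm) map_poly_eq_0_iff) auto
  then have wqp: "w = q * p" using qr(1) by simp
  have lcw: "lead_coeff w = 1" using w by (simp add: weierstrass_poly_def)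
  have lcq: "lead_coeff q = 1"
    using monic_factorD[of q p] lcw lcp by (simp flip: wqp)
  have "f = (u * fps_of_poly q) * fps_of_poly p"
    by (simp add: f wqp fps_of_poly_mult mult.assoc)
  then have "u * fps_of_poly q dvd 1 \<or> fps_of_poly p dvd 1"
    using assms(1) by (rule irreducibleD[rotated])
  moreover have "coeff p 0 $ 0 = 0"
    using w degp lcp by (intro monic_dvd_weierstrass_poly[of p q]) (simp_all add: wqp mult.commute)
  ultimately have "coeff q 0 $ 0 \<noteq> 0"
    by (auto simp: fps2_unit_iff)
  then have "degree q = 0"
    using monic_dvd_weierstrass_poly[of q p] w lcq wqp by auto
  then have "q = 1"
    using lcq by (metis degree_eq_zeroE lead_coeff_pCons(2) one_pCons)
  then show ?thesis by (simp add: wqp p)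
qed

section \<open>Characteristic exponents\<close>

lemma puiseux_root_iff:
  "puiseux_root p m \<alpha> \<longleftrightarrow> m > 0 \<and> poly (map_poly (ramify m) p) \<alpha> = 0"
  by (simp add: puiseux_root_def ramify_def[abs_def])

lemma subdegree_orbit_diff:
  fixes \<alpha> :: "'a::field fps"
  assumes "m > 0" "w ^ m = 1"
  shows "subdegree (twist z \<alpha> - twist w \<alpha>) = subdegree (twist (z / w) \<alpha> - \<alpha>)"
proof -
  have w: "w \<noteq> 0" using root_unity_nonzero assms by blast
  then have "twist z \<alpha> - twist w \<alpha> = twist w (twist (z / w) \<alpha> - \<alpha>)"
    by (simp add: twist_diff twist_twist)
  then show ?thesis by (simp add: subdegree_twist w)
qed

text \<open>\<open>char_set\<close> admits roots in \<open>K[[X^(1/k)]]\<close> for every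
  \<open>k\<close>. Ramifying them by \<open>m\<close> and the given orbit by \<open>k\<close> makes
  both comparable, and the order divided by the denominator does not change.\<close>

lemma char_set_eq_orders:
  fixes p :: "'a::{alg_closed_field, field_char_0} fps poly"
  assumes m: "m > 0" and p: "map_poly (ramify m) p = (\<Prod>\<beta>\<in>orbit m \<alpha>. [:- \<beta>, 1:])"
  shows "char_set p = (\<lambda>k. of_nat k / of_nat m) ` orders m \<alpha>"
proof (intro equalityI subsetI)
  have root_iff: "poly (\<Prod>\<beta>\<in>S. [:- \<beta>, 1:]) x = 0 \<longleftrightarrow> x \<in> S" if "finite S"
    for S and x :: "'a fps"
    using that by (auto simp: poly_prod)
  {
    fix x :: rat assume "x \<in> (\<lambda>k. of_nat k / of_nat m) ` orders m \<alpha>"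
    then obtain z where z: "z ^ m = 1" "twist z \<alpha> \<noteq> \<alpha>"
      "x = of_nat (subdegree (twist z \<alpha> - \<alpha>)) / of_nat m"
      by (auto simp: orders_def)
    have "twist z \<alpha> \<in> orbit m \<alpha>" using z(1) by (auto simp: orbit_def)
    then have "puiseux_root p m (twist z \<alpha>)" "puiseux_root p m \<alpha>"
      using m self_in_orbit[OF m, of \<alpha>] by (simp_all add: puiseux_root_iff p root_iff finite_orbit[OF m])
    then show "x \<in> char_set p"
      using z(2,3) unfolding char_set_def by blast
  }
  fix x assume "x \<in> char_set p"
  then obtain k \<gamma> \<delta> where x: "x = of_nat (subdegree (\<gamma> - \<delta>)) / of_nat k" and "\<gamma> \<noteq> \<delta>"
    and k: "k > 0" and "poly (map_poly (ramify k) p) \<gamma> = 0" "poly (map_poly (ramify k) p) \<delta> = 0"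
    unfolding char_set_def puiseux_root_iff by blast
  interpret ramm: comm_ring_map "ramify m :: 'a fps \<Rightarrow> _"
    using m by (rule ramify_comm_ring_map)
  interpret ramk: comm_ring_map "ramify k :: 'a fps \<Rightarrow> _"
    using k by (rule ramify_comm_ring_map)
  have ram_diff: "ramify m (a - b) = ramify m a - ramify m b"
    "ramify k (a - b) = ramify k a - ramify k b" for a b :: "'a fps"
    by (simp_all add: ramify_def fps_compose_sub_distrib)
  have ram_k: "\<exists>z. z ^ m = 1 \<and> ramify m \<xi> = ramify k (twist z \<alpha>)"
    if "poly (map_poly (ramify k) p) \<xi> = 0" for \<xi>
  proof -
    have "map_poly (ramify m) (map_poly (ramify k) p) = map_poly (ramify k) (map_poly (ramify m) p)"
      using m k by (simp add: map_poly_ramify_ramify mult.commute)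
    also have "\<dots> = (\<Prod>\<beta>\<in>orbit m \<alpha>. [:- ramify k \<beta>, 1:])"
      by (simp only: p ramk.map_poly_prod ramk.map_poly_linear ramk.map_minus)
    finally have "poly (\<Prod>\<beta>\<in>orbit m \<alpha>. [:- ramify k \<beta>, 1:]) (ramify m \<xi>) = 0"
      using ramm.poly_map_poly[of "map_poly (ramify k) p" \<xi>] that by simp
    then obtain \<beta> where "\<beta> \<in> orbit m \<alpha>" "ramify m \<xi> = ramify k \<beta>"
      by (auto simp: poly_prod finite_orbit[OF m])
    then show ?thesis
      by (auto simp: orbit_def)
  qed
  obtain z w where z: "z ^ m = 1" "ramify m \<gamma> = ramify k (twist z \<alpha>)"
    and w: "w ^ m = 1" "ramify m \<delta> = ramify k (twist w \<alpha>)"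
    using ram_k \<open>poly (map_poly (ramify k) p) \<gamma> = 0\<close> \<open>poly (map_poly (ramify k) p) \<delta> = 0\<close> by blast
  have eq: "ramify m (\<gamma> - \<delta>) = ramify k (twist z \<alpha> - twist w \<alpha>)"
    using z(2) w(2) by (simp add: ram_diff)
  have "w \<noteq> 0" using root_unity_nonzero[OF m w(1)] .
  have "twist z \<alpha> - twist w \<alpha> \<noteq> 0"
    using eq \<open>\<gamma> \<noteq> \<delta>\<close> ramify_eq_0_iff[OF m, of "\<gamma> - \<delta>"] by auto
  then have "twist (z / w) \<alpha> \<noteq> \<alpha>"
    using twist_eq_iff[OF \<open>w \<noteq> 0\<close>, of "twist (z / w) \<alpha>" \<alpha>] \<open>w \<noteq> 0\<close> by (auto simp: twist_twist)
  then have "subdegree (twist z \<alpha> - twist w \<alpha>) \<in> orders m \<alpha>"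
    unfolding subdegree_orbit_diff[OF m w(1)] orders_def using z(1) w(1)
    by (auto simp: power_divide)
  moreover have "subdegree (\<gamma> - \<delta>) * m = subdegree (twist z \<alpha> - twist w \<alpha>) * k"
    using arg_cong[OF eq, of subdegree] by (simp add: subdegree_ramify m k)
  then have "x = of_nat (subdegree (twist z \<alpha> - twist w \<alpha>)) / of_nat m"
    using m k unfolding x by (simp add: frac_eq_eq flip: of_nat_mult)
  ultimately show "x \<in> (\<lambda>k. of_nat k / of_nat m) ` orders m \<alpha>" by blast
qed

section \<open>The groups \<open>M_i\<close>, their indices and the numbers \<open>e_i\<close>
  through gcds of exponents\<close>

primrec gcd_chain :: "nat \<Rightarrow> nat list \<Rightarrow> nat \<Rightarrow> nat" where
  "gcd_chain m ks 0 = m"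
| "gcd_chain m ks (Suc i) = gcd (gcd_chain m ks i) (ks ! i)"

lemma gcd_chain_pos: "m > 0 \<Longrightarrow> gcd_chain m ks i > 0"
  by (induction i) auto

lemma power_gcd_chain_eq_1_iff:
  fixes z :: "'a::field"
  assumes "m > 0"
  shows "z ^ gcd_chain m ks i = 1 \<longleftrightarrow> z ^ m = 1 \<and> (\<forall>j<i. z ^ (ks ! j) = 1)"
  by (induction i) (simp_all add: power_gcd_eq_1_iff[OF gcd_chain_pos[OF assms]] All_less_Suc conj_ac)

lemma Mgrp_Suc: "Mgrp h (Suc i) = {y + of_int k * h ! i | y k. y \<in> Mgrp h i}"
proof (intro equalityI subsetI)
  fix x assume "x \<in> Mgrp h (Suc i)"
  then obtain k0 k where "x = of_int k0 + (\<Sum>j<Suc i. of_int (k j) * h ! j)"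
    by (auto simp: Mgrp_def)
  then have "x = (of_int k0 + (\<Sum>j<i. of_int (k j) * h ! j)) + of_int (k i) * h ! i" by simp
  then show "x \<in> {y + of_int k * h ! i | y k. y \<in> Mgrp h i}" by (auto simp: Mgrp_def)
next
  fix x assume "x \<in> {y + of_int k * h ! i | y k. y \<in> Mgrp h i}"
  then obtain k0 k l where x: "x = of_int k0 + (\<Sum>j<i. of_int (k j) * h ! j) + of_int l * h ! i"
    by (auto simp: Mgrp_def)
  define k' where "k' = k(i := l)"
  have "(\<Sum>j<i. of_int (k' j) * h ! j) = (\<Sum>j<i. of_int (k j) * h ! j)" and "k' i = l"
    by (auto simp: k'_def intro: sum.cong)
  then have "x = of_int k0 + (\<Sum>j<Suc i. of_int (k' j) * h ! j)"
    by (simp only: x sum.lessThan_Suc add.assoc)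
  then show "x \<in> Mgrp h (Suc i)" unfolding Mgrp_def by blast
qed

text \<open>By Bezout, adjoining \<open>k / m\<close> to the cyclic group generated by
  \<open>d / m\<close> gives the one generated by \<open>gcd d k / m\<close>. The indices in the
  tower become quotients of successive gcds.\<close>

lemma Mgrp_eq_multiples:
  assumes "m > 0" "i \<le> length ks"
  shows "Mgrp (map (\<lambda>k. of_nat k / of_nat m) ks) i =
    range (\<lambda>x. of_int x * (of_nat (gcd_chain m ks i) / of_nat m))"
  using assms(2)
proof (induction i)
  case 0
  show ?case using assms(1) by (auto simp: Mgrp_def)
next
  case (Suc i)
  let ?d = "gcd_chain m ks i" and ?k = "ks ! i"
  have nth: "map (\<lambda>k. of_nat k / of_nat m :: rat) ks ! i = of_nat ?k / of_nat m"
    using Suc.prems by simp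
  obtain u v where uv: "u * int ?d + v * int ?k = int (gcd ?d ?k)"
    using bezout_int[of "int ?d" "int ?k"] by auto
  show ?case
  proof (intro equalityI subsetI)
    fix x assume "x \<in> Mgrp (map (\<lambda>k. of_nat k / of_nat m) ks) (Suc i)"
    then obtain a b where x: "x = of_int a * (of_nat ?d / of_nat m) + of_int b * (of_nat ?k / of_nat m)"
      using Suc by (auto simp: Mgrp_Suc nth)
    obtain d' k' where dk: "?d = gcd ?d ?k * d'" "?k = gcd ?d ?k * k'"
      by (meson dvdE gcd_dvd1 gcd_dvd2)
    have "x = (of_int a * of_nat ?d + of_int b * of_nat ?k) / of_nat m"
      by (simp add: x add_divide_distrib)
    also have "\<dots> = (of_int a * of_nat (gcd ?d ?k * d') + of_int b * of_nat (gcd ?d ?k * k')) / of_nat m"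
      using dk by simp
    also have "\<dots> = of_int (a * int d' + b * int k') * (of_nat (gcd ?d ?k) / of_nat m)"
      by (simp add: algebra_simps)
    finally show "x \<in> range (\<lambda>x. of_int x * (of_nat (gcd_chain m ks (Suc i)) / of_nat m))"
      unfolding gcd_chain.simps by (rule range_eqI)
  next
    fix x :: rat assume "x \<in> range (\<lambda>x. of_int x * (of_nat (gcd_chain m ks (Suc i)) / of_nat m))"
    then obtain a where "x = of_int a * (of_int (int (gcd ?d ?k)) / of_nat m)" by auto
    then have "x = of_int (a * u) * (of_nat ?d / of_nat m) + of_int (a * v) * (of_nat ?k / of_nat m)"
      by (simp add: algebra_simps add_divide_distrib flip: uv)
    moreover have "of_int (a * u) * (of_nat ?d / of_nat m) \<in> Mgrp (map (\<lambda>k. of_nat k / of_nat m) ks) i"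
      using Suc by (simp only: Suc_leD) (rule rangeI)
    ultimately show "x \<in> Mgrp (map (\<lambda>k. of_nat k / of_nat m) ks) (Suc i)"
      unfolding Mgrp_Suc nth by blast
  qed
qed

lemma subgroup_index_multiples:
  fixes r :: rat
  assumes r: "r > 0" and n: "n > 0"
  shows "subgroup_index (range (\<lambda>x. of_int x * r)) (range (\<lambda>x. of_int x * (of_nat n * r))) = n"
proof -
  let ?N = "range (\<lambda>x. of_int x * (of_nat n * r))"
  define C where "C x = (\<lambda>y. x + y) ` ?N" for x
  have memb: "y \<in> C x \<longleftrightarrow> (\<exists>t. y = x + of_int t * (of_nat n * r))" for x y
    by (auto simp: C_def)
  have C_shift: "C (x + of_int t * (of_nat n * r)) = C x" for x t
  proof (intro set_eqI)
    fix y
    have "(\<exists>s. y = x + of_int t * (of_nat n * r) + of_int s * (of_nat n * r)) \<longleftrightarrow>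
        (\<exists>s. y = x + of_int s * (of_nat n * r))"
    proof
      assume "\<exists>s. y = x + of_int t * (of_nat n * r) + of_int s * (of_nat n * r)"
      then obtain s where "y = x + of_int t * (of_nat n * r) + of_int s * (of_nat n * r)" ..
      then have "y = x + of_int (t + s) * (of_nat n * r)" by (simp add: algebra_simps)
      then show "\<exists>s. y = x + of_int s * (of_nat n * r)" ..
    next
      assume "\<exists>s. y = x + of_int s * (of_nat n * r)"
      then obtain s where "y = x + of_int s * (of_nat n * r)" ..
      then have "y = x + of_int t * (of_nat n * r) + of_int (s - t) * (of_nat n * r)"
        by (simp add: algebra_simps)
      then show "\<exists>s. y = x + of_int t * (of_nat n * r) + of_int s * (of_nat n * r)" ..
    qed
    then show "y \<in> C (x + of_int t * (of_nat n * r)) \<longleftrightarrow> y \<in> C x" by (simp only: memb)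
  qed
  have "C ` range (\<lambda>x. of_int x * r) = (\<lambda>l. C (of_nat l * r)) ` {..<n}"
  proof (intro equalityI subsetI)
    fix c assume "c \<in> C ` range (\<lambda>x. of_int x * r)"
    then obtain a where a: "c = C (of_int a * r)" by auto
    define l where "l = nat (a mod int n)"
    have "int l + (a div int n) * int n = a" using n by (simp add: l_def)
    then have "of_int a = (of_nat l + of_int (a div int n) * of_nat n :: rat)"
      by (metis of_int_add of_int_mult of_int_of_nat_eq)
    then have "of_int a * r = of_nat l * r + of_int (a div int n) * (of_nat n * r)"
      by (simp add: algebra_simps)
    then have "c = C (of_nat l * r)" by (simp only: a C_shift)
    moreover have "l < n" using n by (simp add: l_def nat_less_iff)
    ultimately show "c \<in> (\<lambda>l. C (of_nat l * r)) ` {..<n}" by blast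
  next
    fix c assume "c \<in> (\<lambda>l. C (of_nat l * r)) ` {..<n}"
    then obtain l where "c = C (of_int (int l) * r)" by auto
    then show "c \<in> C ` range (\<lambda>x. of_int x * r)" by blast
  qed
  moreover have "inj_on (\<lambda>l. C (of_nat l * r)) {..<n}"
  proof
    fix l l' assume l: "l \<in> {..<n}" "l' \<in> {..<n}" and "C (of_nat l * r) = C (of_nat l' * r)"
    then have "of_nat l * r \<in> C (of_nat l' * r)"
      by (metis C_shift memb add.right_neutral mult_zero_left of_int_0)
    then obtain t where "of_nat l * r = of_nat l' * r + of_int t * (of_nat n * r)"
      by (auto simp: memb)
    then have "of_nat l * r = (of_nat l' + of_int t * of_nat n) * r"
      by (simp add: algebra_simps)
    then have "of_nat l = (of_nat l' + of_int t * of_nat n :: rat)"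
      using r by (simp only: mult_cancel_right) simp
    then have "of_int (int l) = (of_int (int l' + t * int n) :: rat)" by simp
    then have "int l = int l' + t * int n" by (simp only: of_int_eq_iff)
    then have "int l mod int n = int l' mod int n" by simp
    then show "l = l'" using l by (simp add: mod_less flip: of_nat_mod)
  qed
  ultimately show ?thesis
    unfolding subgroup_index_def C_def[symmetric] by (simp add: card_image)
qed

text \<open>The product of indices that defines \<open>e_i\<close> telescopes. The last gcd remains
  as a factor because \<open>m\<close> is any common denominator, not necessarily the
  smallest.\<close>

lemma eidx_mult_gcd_chain:
  fixes ks :: "nat list" and m :: nat
  defines "h \<equiv> map (\<lambda>k. of_nat k / of_nat m) ks"
  assumes m: "m > 0" and "i \<le> length ks"
  shows "eidx h i * gcd_chain m ks (length ks) = gcd_chain m ks i"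
  using assms(3)
proof (induction rule: inc_induct)
  case base
  then show ?case by (simp add: eidx_def nidx_def h_def)
next
  case (step i)
  let ?d = "gcd_chain m ks"
  obtain n where n: "?d i = n * ?d (Suc i)"
    by (metis dvdE gcd_chain.simps(2) gcd_dvd1 mult.commute)
  have "n > 0" using n gcd_chain_pos[OF m, of ks i] by (cases n) auto
  have "nidx h (Suc i) = subgroup_index (Mgrp h (Suc i)) (Mgrp h i)"
    using step.hyps by (simp add: nidx_def h_def)
  also have "\<dots> = subgroup_index (range (\<lambda>x. of_int x * (of_nat (?d (Suc i)) / of_nat m)))
      (range (\<lambda>x. of_int x * (of_nat n * (of_nat (?d (Suc i)) / of_nat m))))"
    using step.hyps m unfolding h_def by (subst (1 2) Mgrp_eq_multiples[OF m]) (simp_all add: n del: gcd_chain.simps)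
  also have "\<dots> = n"
    using gcd_chain_pos[OF m, of ks "Suc i"] m \<open>n > 0\<close>
    by (intro subgroup_index_multiples) (simp_all del: gcd_chain.simps)
  finally have "nidx h (Suc i) = n" .
  moreover have "eidx h i = nidx h (Suc i) * eidx h (Suc i)"
    using step.hyps unfolding eidx_def h_def by (simp add: prod.atLeast_Suc_atMost)
  ultimately show ?case using step.IH n by (simp del: gcd_chain.simps)
qed

text \<open>The list \<open>ks\<close> holds the characteristic exponents in units of \<open>1/m\<close>. The equation
  \<open>z ^ gcd_chain m ks j = 1\<close> says that \<open>twist z\<close> fixes \<open>\<alpha>\<close> below order \<open>ks ! j\<close>, so \<open>e_j\<close> is
  \<open>gcd_chain m ks j\<close> divided by its last value, the size of the stabiliser.\<close>
context
  fixes m :: nat and \<alpha> :: "'a::{alg_closed_field, field_char_0} fps" and ks :: "nat list"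
  assumes m: "m > 0"
  defines "ks \<equiv> sorted_list_of_set (orders m \<alpha>)"
begin

lemma set_ks: "set ks = orders m \<alpha>"
  by (simp add: ks_def finite_orders[OF m])

lemma ks_mono: "i < j \<Longrightarrow> j < length ks \<Longrightarrow> ks ! i < ks ! j"
  using sorted_wrt_nth_less[of "(<)" ks] by (simp add: ks_def)

lemma twist_coeff_fixed:
  "\<alpha> $ k \<noteq> 0 \<Longrightarrow> k < subdegree (twist z \<alpha> - \<alpha>) \<or> twist z \<alpha> = \<alpha> \<Longrightarrow> z ^ k = 1"
  using nth_less_subdegree_zero[of k "twist z \<alpha> - \<alpha>"] by (auto simp: fps_eq_iff)

lemma twist_coeff_moved:
  assumes "twist z \<alpha> \<noteq> \<alpha>" "k = subdegree (twist z \<alpha> - \<alpha>)"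
  shows "\<alpha> $ k \<noteq> 0" "z ^ k \<noteq> 1"
proof -
  have "(twist z \<alpha> - \<alpha>) $ k \<noteq> 0"
    unfolding assms(2) using assms(1) by (intro nth_subdegree_nonzero) simp
  then show "\<alpha> $ k \<noteq> 0" "z ^ k \<noteq> 1" by auto
qed

lemma coeff_orders_nonzero: "k \<in> orders m \<alpha> \<Longrightarrow> \<alpha> $ k \<noteq> 0"
  unfolding orders_def using twist_coeff_moved(1) by blast

text \<open>If \<open>z\<close> fixed all coefficients at the exponents in \<open>ks\<close> and
  still moved \<alpha>, the first exponent moved would itself be an order, hence in
  \<open>ks\<close>.\<close>

lemma stab_eq: "stab m \<alpha> = {z. z ^ gcd_chain m ks (length ks) = 1}"
proof (intro set_eqI iffI)
  fix z assume z: "z \<in> stab m \<alpha>"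
  then have "z ^ (ks ! j) = 1" if "j < length ks" for j
  proof -
    have "ks ! j \<in> orders m \<alpha>" using that set_ks nth_mem by blast
    then show ?thesis
      using twist_coeff_fixed[OF coeff_orders_nonzero, of "ks ! j" z] z unfolding stab_def by blast
  qed
  then show "z \<in> {z. z ^ gcd_chain m ks (length ks) = 1}"
    using z by (simp add: power_gcd_chain_eq_1_iff[OF m] stab_def)
next
  fix z :: 'a assume "z \<in> {z. z ^ gcd_chain m ks (length ks) = 1}"
  then have z: "z ^ m = 1" "\<forall>j<length ks. z ^ (ks ! j) = 1"
    by (simp_all add: power_gcd_chain_eq_1_iff[OF m])
  have "twist z \<alpha> = \<alpha>"
  proof (rule ccontr)
    assume *: "twist z \<alpha> \<noteq> \<alpha>"
    then have "subdegree (twist z \<alpha> - \<alpha>) \<in> set ks"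
      using z(1) by (auto simp: set_ks orders_def)
    then show False
      using twist_coeff_moved(2)[OF * refl] z(2) by (metis in_set_conv_nth)
  qed
  then show "z \<in> stab m \<alpha>" using z(1) by (simp add: stab_def)
qed

lemma card_stab: "card (stab m \<alpha>) = gcd_chain m ks (length ks)"
  unfolding stab_eq by (intro card_roots_unity_alg_closed gcd_chain_pos m)

text \<open>The order of the difference is some entry of \<open>ks\<close> at which \<open>z\<close>
  moves the coefficient. It is no earlier entry, since \<open>z\<close> fixes those, and no later
  one, since the nonzero coefficient at \<open>ks ! j\<close> is already moved.\<close>

lemma subdegree_twist_diff:
  assumes j: "j < length ks" and z: "z ^ gcd_chain m ks j = 1" "z ^ gcd_chain m ks (Suc j) \<noteq> 1"
  shows "subdegree (twist z \<alpha> - \<alpha>) = ks ! j"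
proof -
  have zm: "z ^ m = 1" and below: "\<forall>i<j. z ^ (ks ! i) = 1" and at: "z ^ (ks ! j) \<noteq> 1"
    using z by (auto simp only: power_gcd_chain_eq_1_iff[OF m] less_Suc_eq)
  have nz: "\<alpha> $ (ks ! j) \<noteq> 0"
    using j set_ks by (intro coeff_orders_nonzero) (metis nth_mem)
  then have moved: "twist z \<alpha> \<noteq> \<alpha>" and le: "subdegree (twist z \<alpha> - \<alpha>) \<le> ks ! j"
    using twist_coeff_fixed[OF nz, of z] at not_less by blast+
  have "subdegree (twist z \<alpha> - \<alpha>) \<in> set ks"
    using moved zm by (auto simp: set_ks orders_def)
  then obtain l where l: "l < length ks" "subdegree (twist z \<alpha> - \<alpha>) = ks ! l"
    by (metis in_set_conv_nth)
  have "\<not> l < j" using below twist_coeff_moved(2)[OF moved refl] l(2) by metis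
  moreover have "\<not> j < l" using ks_mono[of j l] l le by auto
  ultimately show ?thesis using l(2) by simp
qed

text \<open>The groups of \<open>gcd_chain m ks i\<close>-th roots of unity decrease with
  \<open>i\<close>; on the layer between two consecutive ones the contact is constant, and the size
  of the layer is the difference of the gcds.\<close>

lemma sum_subdegree_twist_diff:
  assumes "j \<le> length ks"
  shows "(\<Sum>z \<in> {z. z ^ m = 1} - {z. z ^ gcd_chain m ks j = 1}. subdegree (twist z \<alpha> - \<alpha>)) =
    (\<Sum>i<j. (gcd_chain m ks i - gcd_chain m ks (Suc i)) * ks ! i)"
  using assms
proof (induction j)
  case (Suc j)
  let ?Z = "\<lambda>j. {z :: 'a. z ^ gcd_chain m ks j = 1}"
  have fin: "finite (?Z j)" for j
    by (intro finite_roots_unity_alg_closed gcd_chain_pos m)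
  have fin_m: "finite {z :: 'a. z ^ m = 1}"
    by (intro finite_roots_unity_alg_closed m)
  have sub: "?Z (Suc j) \<subseteq> ?Z j" "?Z j \<subseteq> {z. z ^ m = 1}"
    by (auto simp only: power_gcd_chain_eq_1_iff[OF m])
  have card: "card (?Z j) = gcd_chain m ks j" for j
    by (intro card_roots_unity_alg_closed gcd_chain_pos m)
  have split: "{z. z ^ m = 1} - ?Z (Suc j) = ({z. z ^ m = 1} - ?Z j) \<union> (?Z j - ?Z (Suc j))"
    using sub by blast
  have "(\<Sum>z \<in> ?Z j - ?Z (Suc j). subdegree (twist z \<alpha> - \<alpha>)) = (\<Sum>z \<in> ?Z j - ?Z (Suc j). ks ! j)"
    using Suc.prems by (intro sum.cong refl subdegree_twist_diff) auto
  also have "\<dots> = (gcd_chain m ks j - gcd_chain m ks (Suc j)) * ks ! j"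
    using card_Diff_subset[OF fin sub(1)] by (simp only: sum_constant card of_nat_id)
  finally have "(\<Sum>z \<in> {z. z ^ m = 1} - ?Z (Suc j). subdegree (twist z \<alpha> - \<alpha>)) =
      (\<Sum>z \<in> {z. z ^ m = 1} - ?Z j. subdegree (twist z \<alpha> - \<alpha>)) +
      (gcd_chain m ks j - gcd_chain m ks (Suc j)) * ks ! j"
    unfolding split using fin fin_m by (subst sum.union_disjoint) auto
  then show ?case using Suc by (simp del: gcd_chain.simps)
qed simp

text \<open>Summing contacts over the roots of unity counts each conjugate once per element of the
  stabiliser, whose size is the last gcd. Dividing by it turns the gcds into the \<open>e_j\<close>.
  The root \<alpha> itself contributes \<open>subdegree 0 = 0\<close>.\<close>

lemma qs_eq_sum_over_orbit:
  assumes "orders m \<alpha> \<noteq> {}"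
  shows "of_nat m * qs (map (\<lambda>k. of_nat k / of_nat m) ks) =
    of_nat ((\<Sum>\<beta>\<in>orbit m \<alpha>. subdegree (\<beta> - \<alpha>)) + Max (orders m \<alpha>))"
proof -
  define s where "s = length ks"
  define h :: "rat list" where "h = map (\<lambda>k. of_nat k / of_nat m) ks"
  let ?d = "gcd_chain m ks"
  have "ks \<noteq> []" using assms set_ks by auto
  then have s: "s > 0" by (simp add: s_def)
  have ds: "?d s > 0" by (rule gcd_chain_pos[OF m])
  have d: "?d i = eidx h i * ?d s" if "i \<le> s" for i
    using eidx_mult_gcd_chain[OF m, of i ks] that by (simp add: h_def s_def)
  have es: "eidx h s = 1" using d[of s] ds by simp
  have h_nth: "of_nat m * h ! i = of_nat (ks ! i)" if "i < s" for i
    using that m by (simp add: h_def s_def)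
  have "?d s * (\<Sum>\<beta>\<in>orbit m \<alpha>. subdegree (\<beta> - \<alpha>)) = (\<Sum>z | z ^ m = 1. subdegree (twist z \<alpha> - \<alpha>))"
    unfolding sum_over_orbit[OF m, of "\<lambda>\<beta>. subdegree (\<beta> - \<alpha>)"] by (simp add: card_stab s_def)
  also have "\<dots> = (\<Sum>z \<in> {z. z ^ m = 1} - {z. z ^ ?d s = 1}. subdegree (twist z \<alpha> - \<alpha>))"
    using finite_roots_unity_alg_closed[OF m]
    by (intro sum.mono_neutral_right) (auto simp: stab_def s_def simp flip: stab_eq)
  also have "\<dots> = (\<Sum>i<s. (?d i - ?d (Suc i)) * ks ! i)"
    by (rule sum_subdegree_twist_diff) (simp add: s_def)
  also have "\<dots> = ?d s * (\<Sum>i<s. (eidx h i - eidx h (Suc i)) * ks ! i)"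
    unfolding sum_distrib_left
  proof (intro sum.cong refl)
    fix i assume "i \<in> {..<s}"
    then have "?d i - ?d (Suc i) = (eidx h i - eidx h (Suc i)) * ?d s"
      using d[of i] d[of "Suc i"] by (simp only: diff_mult_distrib) simp
    then show "(?d i - ?d (Suc i)) * ks ! i = ?d s * ((eidx h i - eidx h (Suc i)) * ks ! i)"
      by (simp only: mult_ac)
  qed
  finally have sum: "(\<Sum>\<beta>\<in>orbit m \<alpha>. subdegree (\<beta> - \<alpha>)) = (\<Sum>i<s. (eidx h i - eidx h (Suc i)) * ks ! i)"
    using ds by simp
  \<comment> \<open>The differences of the \<open>e_j\<close> are truncated in \<open>nat\<close>
    here but taken in \<open>rat\<close> in \<open>qs\<close>; monotonicity reconciles them.\<close>
  have mono: "eidx h (Suc i) \<le> eidx h i" if "i < s" for i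
  proof -
    have "?d (Suc i) \<le> ?d i"
      using gcd_chain_pos[OF m, of ks i] by (simp add: gcd_le1_nat)
    then show ?thesis using d[of i] d[of "Suc i"] that ds by simp
  qed
  have max: "Max (orders m \<alpha>) = ks ! (s - 1)"
  proof (rule Max_eqI[OF finite_orders[OF m]])
    fix k assume "k \<in> orders m \<alpha>"
    then obtain i where i: "i < s" "k = ks ! i" by (metis set_ks in_set_conv_nth s_def)
    then consider "i = s - 1" | "i < s - 1" by linarith
    then show "k \<le> ks ! (s - 1)"
    proof cases
      case 2
      then have "ks ! i < ks ! (s - 1)" using s by (intro ks_mono) (simp_all add: s_def)
      then show ?thesis using i(2) by simp
    qed (simp add: i(2))
  qed (use s set_ks in \<open>simp add: s_def flip: set_ks\<close>)
  have "of_nat m * qs h =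
      of_nat m * ((\<Sum>j<s. (of_nat (eidx h j) - of_nat (eidx h (Suc j))) * h ! j) + h ! (s - 1))"
  proof -
    have "h \<noteq> []" "length h = s" using \<open>ks \<noteq> []\<close> by (simp_all add: h_def s_def)
    then show ?thesis by (simp add: qs_def es sum.atLeast1_atMost_eq)
  qed
  also have "\<dots> = (\<Sum>j<s. (of_nat (eidx h j) - of_nat (eidx h (Suc j))) * (of_nat m * h ! j)) +
      of_nat m * h ! (s - 1)"
    by (simp add: distrib_left sum_distrib_left mult_ac)
  also have "\<dots> = (\<Sum>j<s. of_nat ((eidx h j - eidx h (Suc j)) * ks ! j)) + of_nat (ks ! (s - 1))"
    using s mono by (intro arg_cong2[where f = "(+)"] sum.cong) (simp_all add: h_nth of_nat_diff)
  also have "\<dots> = of_nat ((\<Sum>\<beta>\<in>orbit m \<alpha>. subdegree (\<beta> - \<alpha>)) + Max (orders m \<alpha>))"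
    by (simp add: sum max)
  finally show ?thesis by (simp add: h_def)
qed

lemma sorted_list_of_scaled_orders:
  "sorted_list_of_set ((\<lambda>k. of_nat k / of_nat m :: rat) ` orders m \<alpha>) =
    map (\<lambda>k. of_nat k / of_nat m) ks"
proof -
  have "sorted_wrt (<) ks" unfolding ks_def by simp
  then have "sorted_wrt (<) (map (\<lambda>k. of_nat k / of_nat m :: rat) ks)"
    using m by (simp add: sorted_wrt_map divide_strict_right_mono sorted_wrt_mono_rel[rotated])
  then show ?thesis
    using finite_orders[OF m, of \<alpha>] set_ks
    by (metis finite_imageI list.set_map sorted_list_of_set_unique length_map strict_sorted_iff
        distinct_card)
qed

end

section \<open>Roots close to a root of an irreducible series\<close>

lemma y_regular_factor:
  fixes a b :: "'a::field fps fps"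
  assumes "y_regular (a * b) n"
  obtains k where "y_regular a k"
proof -
  have "\<exists>j. a $ j $ 0 \<noteq> 0"
  proof (rule ccontr)
    assume "\<not> ?thesis"
    then have "(a * b) $ n $ 0 = 0" by (simp add: fps_mult_nth fps_sum_nth)
    then show False using assms by (simp add: y_regular_def)
  qed
  then have "a $ (LEAST j. a $ j $ 0 \<noteq> 0) $ 0 \<noteq> 0" by (rule LeastI_ex)
  then have "y_regular a (LEAST j. a $ j $ 0 \<noteq> 0)"
    unfolding y_regular_def using not_less_Least by blast
  then show thesis by (rule that)
qed

text \<open>The ultrametric inequality bounds the order of \<open>F(\<beta>)\<close> by the contact of \<open>\<beta>\<close> with the
  closest root of \<open>F\<close> plus the mutual contacts of that root with its conjugates.\<close>
lemma close_orbit_element: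
  fixes \<beta> :: "'a::{alg_closed_field, field_char_0} fps" and R :: "'a fps set"
  defines "F \<equiv> \<Prod>\<alpha>\<in>R. [:- \<alpha>, 1:]"
  assumes R: "finite R" "R \<noteq> {}" and m: "m > 0"
    and orb: "\<And>\<alpha>. \<alpha> \<in> R \<Longrightarrow> orbit m \<alpha> = R"
    and q: "\<And>\<alpha>. \<alpha> \<in> R \<Longrightarrow>
      q = qs (sorted_list_of_set ((\<lambda>k. of_nat k / of_nat m) ` orders m \<alpha>))"
    and F: "poly F \<beta> = 0 \<or> of_nat (subdegree (poly F \<beta>)) > of_nat m * q"
  obtains \<alpha> where "\<alpha> \<in> R" "\<And>k. k \<in> orders m \<alpha> \<Longrightarrow> \<beta> = \<alpha> \<or> k < subdegree (\<beta> - \<alpha>)"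
proof (cases "poly F \<beta> = 0")
  \<comment> \<open>Here \<beta> is itself a root and its contact with
    \<open>\<alpha> = \<beta>\<close> is infinite; as \<open>subdegree 0 = 0\<close>, this needs the
    separate alternative \<open>\<beta> = \<alpha>\<close>.\<close>
  case True
  then have "\<beta> \<in> R" using R(1) by (auto simp: F_def poly_prod)
  then show thesis by (intro that[of \<beta>]) auto
next
  case False
  then have ne: "\<beta> - \<alpha> \<noteq> 0" if "\<alpha> \<in> R" for \<alpha>
    using R(1) that by (auto simp: F_def poly_prod)
  have "subdegree (poly F \<beta>) = (\<Sum>\<alpha>\<in>R. subdegree (\<beta> - \<alpha>))"
    unfolding F_def poly_prod using ne by (subst subdegree_prod) auto
  with F False have big: "of_nat (\<Sum>\<alpha>\<in>R. subdegree (\<beta> - \<alpha>)) > of_nat m * q" by simp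
  have "finite ((\<lambda>\<alpha>. subdegree (\<beta> - \<alpha>)) ` R)" "(\<lambda>\<alpha>. subdegree (\<beta> - \<alpha>)) ` R \<noteq> {}"
    using R by auto
  then have "Max ((\<lambda>\<alpha>. subdegree (\<beta> - \<alpha>)) ` R) \<in> (\<lambda>\<alpha>. subdegree (\<beta> - \<alpha>)) ` R"
    by (rule Max_in)
  then obtain \<alpha> where \<alpha>: "\<alpha> \<in> R" "Max ((\<lambda>\<alpha>. subdegree (\<beta> - \<alpha>)) ` R) = subdegree (\<beta> - \<alpha>)"
    by blast
  have max: "subdegree (\<beta> - \<gamma>) \<le> subdegree (\<beta> - \<alpha>)" if "\<gamma> \<in> R" for \<gamma>
    unfolding \<alpha>(2)[symmetric] using R(1) that by (intro Max_ge) auto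
  \<comment> \<open>As \<alpha> is the root closest to \<beta>, \<open>\<gamma> - \<alpha>\<close>
    is a difference of \<open>\<beta> - \<alpha>\<close> and \<open>\<beta> - \<gamma>\<close>, both
    of order at least that of \<open>\<beta> - \<gamma>\<close>.\<close>
  have le: "subdegree (\<beta> - \<gamma>) \<le> subdegree (\<gamma> - \<alpha>)" if "\<gamma> \<in> R - {\<alpha>}" for \<gamma>
  proof (rule subdegree_geI)
    show "\<gamma> - \<alpha> \<noteq> 0" using that by simp
    fix i assume i: "i < subdegree (\<beta> - \<gamma>)"
    then have "(\<beta> - \<gamma>) $ i = 0" "(\<beta> - \<alpha>) $ i = 0"
      using max[of \<gamma>] that by (auto intro!: nth_less_subdegree_zero simp del: fps_sub_nth)
    then show "(\<gamma> - \<alpha>) $ i = 0" by simp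
  qed
  \<comment> \<open>The sum of the contacts of \<alpha> with its conjugates occurs both in
    \<open>m * q\<close> and in the ultrametric bound; cancelling it leaves the largest order below
    the contact with \<beta>. The given \<open>k\<close> ensures that this maximum exists.\<close>
  have "\<beta> = \<alpha> \<or> k < subdegree (\<beta> - \<alpha>)" if k: "k \<in> orders m \<alpha>" for k
  proof -
    have "(\<Sum>\<gamma>\<in>R. subdegree (\<beta> - \<gamma>)) = subdegree (\<beta> - \<alpha>) + (\<Sum>\<gamma>\<in>R - {\<alpha>}. subdegree (\<beta> - \<gamma>))"
      using R(1) \<alpha>(1) by (rule sum.remove)
    also have "\<dots> \<le> subdegree (\<beta> - \<alpha>) + (\<Sum>\<gamma>\<in>R - {\<alpha>}. subdegree (\<gamma> - \<alpha>))"
      using le by (intro add_left_mono sum_mono)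
    also have "\<dots> \<le> subdegree (\<beta> - \<alpha>) + (\<Sum>\<gamma>\<in>R. subdegree (\<gamma> - \<alpha>))"
      using R(1) by (intro add_left_mono sum_mono2) auto
    finally have upper: "(\<Sum>\<gamma>\<in>R. subdegree (\<beta> - \<gamma>)) \<le> subdegree (\<beta> - \<alpha>) + (\<Sum>\<gamma>\<in>R. subdegree (\<gamma> - \<alpha>))" .
    have "of_nat m * q = of_nat ((\<Sum>\<gamma>\<in>R. subdegree (\<gamma> - \<alpha>)) + Max (orders m \<alpha>))"
      using qs_eq_sum_over_orbit[OF m, of \<alpha>] k q[OF \<alpha>(1)] sorted_list_of_scaled_orders[OF m, of \<alpha>]
        orb[OF \<alpha>(1)] by auto
    then have "(\<Sum>\<gamma>\<in>R. subdegree (\<gamma> - \<alpha>)) + Max (orders m \<alpha>) < (\<Sum>\<alpha>\<in>R. subdegree (\<beta> - \<alpha>))"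
      using big by (simp only: of_nat_less_iff)
    then have "Max (orders m \<alpha>) < subdegree (\<beta> - \<alpha>)" using upper by linarith
    moreover have "k \<le> Max (orders m \<alpha>)" using finite_orders[OF m] k by (rule Max_ge)
    ultimately show ?thesis by simp
  qed
  with \<alpha>(1) show thesis by (rule that)
qed

text \<open>The two series agree up to and including the first exponent at which \<open>z\<close>
  moves \<alpha>, so \<open>z\<close> moves \<beta> first at the same exponent.\<close>

lemma close_subdegree_twist_diff:
  fixes \<alpha> \<beta> :: "'a::{alg_closed_field, field_char_0} fps"
  assumes "\<And>k. k \<in> orders m \<alpha> \<Longrightarrow> \<beta> = \<alpha> \<or> k < subdegree (\<beta> - \<alpha>)"
    and z: "z ^ m = 1" "twist z \<alpha> \<noteq> \<alpha>"
  shows "twist z \<beta> \<noteq> \<beta>" "subdegree (twist z \<beta> - \<beta>) = subdegree (twist z \<alpha> - \<alpha>)"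
proof -
  define k where "k = subdegree (twist z \<alpha> - \<alpha>)"
  have "k \<in> orders m \<alpha>" using z by (auto simp: orders_def k_def)
  then have *: "\<beta> = \<alpha> \<or> k < subdegree (\<beta> - \<alpha>)" by (rule assms(1))
  have agree: "\<beta> $ i = \<alpha> $ i" if "i \<le> k" for i
    using nth_less_subdegree_zero[of i "\<beta> - \<alpha>"] * that by auto
  have "(twist z \<alpha> - \<alpha>) $ k \<noteq> 0"
    unfolding k_def using z(2) by (intro nth_subdegree_nonzero) simp
  then have nz: "(twist z \<beta> - \<beta>) $ k \<noteq> 0" using agree[of k] by simp
  then show "twist z \<beta> \<noteq> \<beta>" by (metis diff_self fps_zero_nth)
  show "subdegree (twist z \<beta> - \<beta>) = subdegree (twist z \<alpha> - \<alpha>)"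
    unfolding k_def[symmetric]
  proof (rule subdegreeI[OF nz])
    fix i assume "i < k"
    then have "(twist z \<alpha> - \<alpha>) $ i = 0"
      unfolding k_def by (rule nth_less_subdegree_zero)
    then show "(twist z \<beta> - \<beta>) $ i = 0" using agree[of i] \<open>i < k\<close> by simp
  qed
qed

text \<open>A twist that fixes \<beta> fixes \<alpha>, so the stabiliser of \<beta> is no larger and
  its orbit no smaller; that orbit consists of roots of \<open>p\<close>. If the degree is
  \<open>card (orbit m \<alpha>)\<close>, all these inequalities are equalities. The first claim,
  applied to factors of \<open>g1\<close>, gives irreducibility of \<open>g\<close>.\<close>

lemma close_root:
  fixes \<alpha> \<beta> :: "'a::{alg_closed_field, field_char_0} fps"
  assumes m: "m > 0" and close: "\<And>k. k \<in> orders m \<alpha> \<Longrightarrow> \<beta> = \<alpha> \<or> k < subdegree (\<beta> - \<alpha>)"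
    and monic: "lead_coeff p = 1" and root: "poly (map_poly (ramify m) p) \<beta> = 0"
  shows "card (orbit m \<alpha>) \<le> degree p"
    and "degree p = card (orbit m \<alpha>) \<Longrightarrow>
      map_poly (ramify m) p = (\<Prod>\<gamma>\<in>orbit m \<beta>. [:- \<gamma>, 1:]) \<and> orders m \<beta> = orders m \<alpha>"
proof -
  interpret ram: comm_ring_map "ramify m :: 'a fps \<Rightarrow> _"
    using m by (rule ramify_comm_ring_map)
  let ?P = "map_poly (ramify m) p"
  have P: "lead_coeff ?P = 1" "degree ?P = degree p"
    using monic by (rule ram.lead_coeff_map_poly_monic ram.degree_map_poly_monic)+
  have roots: "poly ?P \<gamma> = 0" if "\<gamma> \<in> orbit m \<beta>" for \<gamma>
    using orbit_subset_roots[OF m root that] .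
  have "?P \<noteq> 0" using P(1) by auto
  have "card (orbit m \<beta>) \<le> card {x. poly ?P x = 0}"
    using roots by (intro card_mono poly_roots_finite \<open>?P \<noteq> 0\<close>) auto
  also have "\<dots> \<le> degree p"
    using card_poly_roots_bound[OF \<open>?P \<noteq> 0\<close>] P(2) by simp
  finally have le_p: "card (orbit m \<beta>) \<le> degree p" .
  have stab_subset: "stab m \<beta> \<subseteq> stab m \<alpha>"
    using close_subdegree_twist_diff(1)[OF close] by (auto simp: stab_def)
  have fin: "finite (stab m \<alpha>)"
    using finite_roots_unity_alg_closed[OF m, where 'a = 'a] unfolding stab_def by (rule rev_finite_subset) auto
  have prods: "card (stab m \<alpha>) * card (orbit m \<alpha>) = m" "card (stab m \<beta>) * card (orbit m \<beta>) = m"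
    by (intro card_orbit m)+
  have stab_le: "card (stab m \<beta>) \<le> card (stab m \<alpha>)"
    using fin stab_subset by (rule card_mono)
  have orbit_le: "card (orbit m \<alpha>) \<le> card (orbit m \<beta>)"
  proof (rule ccontr)
    assume "\<not> ?thesis"
    then have "card (stab m \<beta>) * card (orbit m \<beta>) < card (stab m \<alpha>) * card (orbit m \<alpha>)"
      using stab_le prods m by (intro mult_le_less_imp_less) (auto intro: Nat.gr0I)
    then show False using prods by simp
  qed
  then show "card (orbit m \<alpha>) \<le> degree p" using le_p by simp
  assume deg: "degree p = card (orbit m \<alpha>)"
  then have card_eq: "card (orbit m \<beta>) = card (orbit m \<alpha>)" using orbit_le le_p by simp
  have "?P = (\<Prod>\<gamma>\<in>orbit m \<beta>. [:- \<gamma>, 1:])"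
    using roots P card_eq deg by (intro monic_eq_prod_linear finite_orbit m) auto
  moreover have "card (stab m \<beta>) = card (stab m \<alpha>)"
    using prods card_eq m by (metis mult_cancel2 mult_0_right less_numeral_extra(3))
  then have "stab m \<beta> = stab m \<alpha>"
    using fin stab_subset by (intro card_subset_eq)
  then have "twist z \<beta> \<noteq> \<beta> \<longleftrightarrow> twist z \<alpha> \<noteq> \<alpha>" if "z ^ m = 1" for z
    using that by (auto simp: stab_def)
  then have "orders m \<beta> = orders m \<alpha>"
    using close_subdegree_twist_diff(2)[OF close] unfolding orders_def by (metis (lifting))
  ultimately show "?P = (\<Prod>\<gamma>\<in>orbit m \<beta>. [:- \<gamma>, 1:]) \<and> orders m \<beta> = orders m \<alpha>" by simp
qed

lemma Char_eq_orders:
  fixes w :: "'a::{alg_closed_field, field_char_0} fps poly"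
  assumes "weierstrass_poly w" "u $ 0 $ 0 \<noteq> 0" "f = u * fps_of_poly w"
    and "m > 0" "map_poly (ramify m) w = (\<Prod>\<beta>\<in>orbit m \<alpha>. [:- \<beta>, 1:])"
  shows "Char f = sorted_list_of_set ((\<lambda>k. of_nat k / of_nat m) ` orders m \<alpha>)"
  unfolding Char_def weierstrass_part_eqI[OF assms(1-3)] char_set_eq_orders[OF assms(4,5)] ..

lemma splits_degree:
  assumes "splits m p bs" "lead_coeff p = 1"
  shows "length bs = degree p"
  using assms comm_ring_map.degree_map_poly_monic[OF ramify_comm_ring_map, of m p]
  by (simp add: splits_def degree_prod_list_linear)

lemma splits_root:
  assumes "splits m p bs" "\<beta> \<in> set bs"
  shows "poly (map_poly (ramify m) p) \<beta> = 0"
proof -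
  have "poly (\<Prod>\<gamma>\<leftarrow>bs. [:- \<gamma>, 1:]) \<beta> = 0"
    using assms(2) by (induction bs) auto
  then show ?thesis using assms(1) by (simp add: splits_def)
qed

lemma i0_upper_bound:
  fixes f g :: "'a::field fps fps"
  assumes "y_regular g n" "fps_of_poly f1 = u * f" "fps_of_poly g1 = v * g"
    and "splits m g1 bs" "lead_coeff g1 = 1" "degree g1 = n"
    and nz: "\<And>\<beta>. \<beta> \<in> set bs \<Longrightarrow> poly (map_poly (ramify m) f1) \<beta> \<noteq> 0"
    and bound: "\<And>\<beta>. \<beta> \<in> set bs \<Longrightarrow>
      of_nat (subdegree (poly (map_poly (ramify m) f1) \<beta>)) \<le> of_nat m * (q :: rat)"
  obtains k where "i0 f g = enat k" "of_nat k \<le> of_nat n * q"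
proof -
  have le: "of_nat k \<le> of_nat n * q" if "indep_mod f g k b" for k b
  proof -
    have "k * m \<le> (\<Sum>\<beta>\<leftarrow>bs. subdegree (poly (map_poly (ramify m) f1) \<beta>))"
      using that by (intro indep_mod_bound[OF assms(1-4) nz])
    then have "of_nat (k * m) \<le> (of_nat (\<Sum>\<beta>\<leftarrow>bs. subdegree (poly (map_poly (ramify m) f1) \<beta>)) :: rat)"
      by (simp only: of_nat_le_iff)
    also have "\<dots> = (\<Sum>\<beta>\<leftarrow>bs. of_nat (subdegree (poly (map_poly (ramify m) f1) \<beta>)))"
      by (induction bs) simp_all
    also have "\<dots> \<le> (\<Sum>\<beta>\<leftarrow>bs. of_nat m * q)"
      using bound by (rule sum_list_mono)
    also have "\<dots> = of_nat n * q * of_nat m"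
      using splits_degree[OF assms(4,5)] assms(6) by (simp add: sum_list_triv mult_ac)
    finally have "of_nat k * of_nat m \<le> of_nat n * q * of_nat m" by simp
    then show ?thesis
      using assms(4) by (simp add: splits_def mult_le_cancel_right)
  qed
  \<comment> \<open>The empty family shows \<open>n * q \<ge> 0\<close>, so \<open>nat\<close> of
    the floor truncates nothing.\<close>
  have "indep_mod f g 0 (\<lambda>_. 0)" by (simp add: indep_mod_def)
  then have "0 \<le> of_nat n * q" using le by fastforce
  moreover have "i0 f g \<le> enat (nat \<lfloor>of_nat n * q\<rfloor>)"
    unfolding i0_def
  proof (rule SUP_least, clarify)
    fix k b assume "indep_mod f g k b"
    then show "enat k \<le> enat (nat \<lfloor>of_nat n * q\<rfloor>)"
      using le le_floor_iff[of "int k" "of_nat n * q"] by fastforce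
  qed
  then obtain k where "i0 f g = enat k" "k \<le> nat \<lfloor>of_nat n * q\<rfloor>"
    by (metis enat_ile enat_ord_simps(1))
  ultimately show thesis
    using that[of k] by (simp add: le_nat_iff le_floor_iff)
qed

theorem theorem5p2:
  fixes f g :: "'a::{alg_closed_field, field_char_0} fps fps"
    and n :: nat
  assumes "irreducible f"
    and "i0 f varX = enat n"
    and "i0 g varX = enat n"
    and "i0 f g = \<infinity> \<or> (\<exists>k. i0 f g = enat k \<and> of_nat k > of_nat n * qs (Char f))"
  shows "irreducible g \<and> Char g = Char f"
proof -
  have reg: "y_regular f n" "y_regular g n"
    using assms(2,3) by (auto intro: i0_varX_eq_imp_y_regular)
  obtain u f1 where f1: "weierstrass_poly f1" "degree f1 = n" "u $ 0 $ 0 \<noteq> 0" "f = u * fps_of_poly f1"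
    using weierstrass_preparation[OF reg(1)] .
  obtain v g1 where g1: "weierstrass_poly g1" "degree g1 = n" "v $ 0 $ 0 \<noteq> 0" "g = v * fps_of_poly g1"
    using weierstrass_preparation[OF reg(2)] .
  have monic: "lead_coeff f1 = 1" "lead_coeff g1 = 1"
    using f1(1) g1(1) by (auto simp: weierstrass_poly_def)
  obtain m1 as1 m2 bs2 where "splits m1 f1 as1" "splits m2 g1 bs2"
    using puiseux monic by metis
  define m where "m = m1 * m2"
  have m12: "m1 > 0" "m2 > 0"
    using \<open>splits m1 f1 as1\<close> \<open>splits m2 g1 bs2\<close> by (simp_all add: splits_def)
  then have m: "m > 0" by (simp add: m_def)
  obtain as where as: "splits m f1 as"
    using splits_ramify[OF \<open>splits m1 f1 as1\<close> m12(2)] unfolding m_def by blast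
  obtain bs where bs: "splits m g1 bs"
    using splits_ramify[OF \<open>splits m2 g1 bs2\<close> m12(1)] unfolding m_def mult.commute[of m1] by blast
  have "\<not> f dvd 1" using assms(1) by (simp add: irreducible_def)
  then have n: "n > 0" using reg(1) by (cases n) (auto simp: fps2_unit_iff y_regular_0_iff)
  have "as \<noteq> []" using splits_degree[OF as monic(1)] f1(2) n by auto
  then obtain \<alpha>0 where \<alpha>0: "\<alpha>0 \<in> set as" by (meson last_in_set)
  define R where "R = orbit m \<alpha>0"
  let ?F = "map_poly (ramify m) f1"
  have F_orbit: "?F = (\<Prod>\<beta>\<in>orbit m \<alpha>. [:- \<beta>, 1:])" if "poly ?F \<alpha> = 0" for \<alpha>
    using irreducible_roots_orbit[OF assms(1) f1(1,4) m that] .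
  have F: "?F = (\<Prod>\<beta>\<in>R. [:- \<beta>, 1:])"
    unfolding R_def using F_orbit splits_root[OF as \<alpha>0] .
  have finR: "finite R" "R \<noteq> {}"
    unfolding R_def using finite_orbit[OF m] self_in_orbit[OF m] by blast+
  have root_iff: "poly (\<Prod>\<beta>\<in>S. [:- \<beta>, 1:]) x = 0 \<longleftrightarrow> x \<in> S" if "finite S" for S and x :: "'a fps"
    using that by (auto simp: poly_prod)
  have orbit_R: "orbit m \<alpha> = R" if "\<alpha> \<in> R" for \<alpha>
  proof -
    have "poly ?F \<alpha> = 0" using that unfolding F root_iff[OF finR(1)] .
    then have "(\<Prod>\<beta>\<in>R. [:- \<beta>, 1:]) = (\<Prod>\<beta>\<in>orbit m \<alpha>. [:- \<beta>, 1:])"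
      using F_orbit F by simp
    then show ?thesis
      using root_iff[OF finR(1)] root_iff[OF finite_orbit[OF m]] by (metis subsetI subset_antisym)
  qed
  have Char_f: "Char f = sorted_list_of_set ((\<lambda>k. of_nat k / of_nat m) ` orders m \<alpha>)" if "\<alpha> \<in> R" for \<alpha>
    using Char_eq_orders[OF f1(1,3,4) m] F orbit_R[OF that] by simp
  have "\<exists>\<beta>\<in>set bs. poly ?F \<beta> = 0 \<or> of_nat (subdegree (poly ?F \<beta>)) > of_nat m * qs (Char f)"
  proof (rule ccontr)
    assume contra: "\<not> ?thesis"
    obtain u' v' where u': "1 = u * u'" and v': "1 = v * v'"
      using f1(3) g1(3) by (metis fps2_unit_iff dvdE)
    have "u' * f = (u * u') * fps_of_poly f1" "v' * g = (v * v') * fps_of_poly g1"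
      unfolding f1(4) g1(4) by (simp_all only: ac_simps)
    then have units: "fps_of_poly f1 = u' * f" "fps_of_poly g1 = v' * g"
      by (simp_all flip: u' v')
    have "poly ?F \<beta> \<noteq> 0" "of_nat (subdegree (poly ?F \<beta>)) \<le> of_nat m * qs (Char f)"
      if "\<beta> \<in> set bs" for \<beta>
      using contra that by (auto simp: not_less)
    then obtain k where "i0 f g = enat k" "of_nat k \<le> of_nat n * qs (Char f)"
      by (rule i0_upper_bound[OF reg(2) units bs monic(2) g1(2)])
    then show False using assms(4) by auto
  qed
  then obtain \<beta> where \<beta>: "\<beta> \<in> set bs"
    "poly ?F \<beta> = 0 \<or> of_nat (subdegree (poly ?F \<beta>)) > of_nat m * qs (Char f)" by blast
  obtain \<alpha> where \<alpha>: "\<alpha> \<in> R"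
    and close: "\<And>k. k \<in> orders m \<alpha> \<Longrightarrow> \<beta> = \<alpha> \<or> k < subdegree (\<beta> - \<alpha>)"
    using close_orbit_element[OF finR m orbit_R, of "qs (Char f)" \<beta>] Char_f \<beta>(2) unfolding F by metis
  have card_R: "card (orbit m \<alpha>) = n"
    using orbit_R[OF \<alpha>] prod_linear_monic(1)[OF finR(1)] f1(2)
      comm_ring_map.degree_map_poly_monic[OF ramify_comm_ring_map[OF m] monic(1)] by (simp flip: F)
  have G: "map_poly (ramify m) g1 = (\<Prod>\<gamma>\<in>orbit m \<beta>. [:- \<gamma>, 1:])" "orders m \<beta> = orders m \<alpha>"
    using close_root(2)[OF m close monic(2) splits_root[OF bs \<beta>(1)]] card_R g1(2) by auto
  have "Char g = Char f"
    using Char_eq_orders[OF g1(1,3,4) m G(1)] Char_f[OF \<alpha>] G(2) by simp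
  moreover have "irreducible g"
  proof (rule irreducibleI)
    show "g \<noteq> 0" using reg(2) by (auto simp: y_regular_def)
    show "\<not> g dvd 1" using reg(2) n by (simp add: fps2_unit_iff y_regular_def)
    fix a b assume gab: "g = a * b"
    show "a dvd 1 \<or> b dvd 1"
    proof (rule ccontr)
      assume nonunit: "\<not> (a dvd 1 \<or> b dvd 1)"
      obtain k l where kl: "y_regular a k" "y_regular b l"
        using y_regular_factor reg(2) gab by (metis mult.commute)
      obtain ua a1 where a1: "weierstrass_poly a1" "degree a1 = k" "ua $ 0 $ 0 \<noteq> 0" "a = ua * fps_of_poly a1"
        using weierstrass_preparation[OF kl(1)] .
      obtain ub b1 where b1: "weierstrass_poly b1" "degree b1 = l" "ub $ 0 $ 0 \<noteq> 0" "b = ub * fps_of_poly b1"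
        using weierstrass_preparation[OF kl(2)] .
      have "k > 0" "l > 0"
        using kl nonunit by (auto simp: fps2_unit_iff y_regular_0_iff intro!: Nat.gr0I)
      have "k + l = n"
        using y_regular_unique[OF y_regular_mult[OF kl]] reg(2) gab by simp
      have "g1 = a1 * b1"
      proof (rule weierstrass_poly_unique[OF g1(1,3,4)])
        show "weierstrass_poly (a1 * b1)" using a1(1) b1(1) by (rule weierstrass_poly_mult)
        show "(ua * ub) $ 0 $ 0 \<noteq> 0" using a1(3) b1(3) by (simp add: fps_mult_nth_0)
        show "g = (ua * ub) * fps_of_poly (a1 * b1)"
          by (simp add: gab a1(4) b1(4) fps_of_poly_mult mult_ac)
      qed
      then have "poly (map_poly (ramify m) a1 * map_poly (ramify m) b1) \<beta> = 0"
        using splits_root[OF bs \<beta>(1)] by (simp add: comm_ring_map.map_poly_mult[OF ramify_comm_ring_map[OF m]])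
      then have "poly (map_poly (ramify m) a1) \<beta> = 0 \<or> poly (map_poly (ramify m) b1) \<beta> = 0" by simp
      \<comment> \<open>Whichever factor vanishes at \<beta> has degree at least \<open>n\<close>,
        yet both degrees are positive with sum \<open>n\<close>.\<close>
      then have "n \<le> k \<or> n \<le> l"
        using close_root(1)[OF m close] a1(1,2) b1(1,2) card_R by (auto simp: weierstrass_poly_def)
      then show False using \<open>k > 0\<close> \<open>l > 0\<close> \<open>k + l = n\<close> by linarith
    qed
  qed
  ultimately show ?thesis by simp
qed

end
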